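(* Let $\mathcal{L}=(L,\vee,\wedge)$ be a finite distributive lattice, and let $a,b,c,d: L\to\mathbb{R}_{\ge 0}$ be four functions such that $$a(x)\,b(y)\ \le\ c(x\vee y)\,d(x\wedge y)\qquad\text{for all } x,y\in L.$$ Assume that $\mathcal{L}$ is the lattice closure of $\operatorname{supp}(a+b+c+d)$. Then $$\sum_{x\in L}a(x)\cdot\sum_{x\in L}b(x)\ =\ \sum_{x\in L}c(x)\cdot\sum_{x\in L}d(x)$$ if and only if the functions $a,b,c,d$ cross-factor on $\mathcal{L}$.
   Context: For $f:L\to\mathbb{R}_{\ge0}$, $\operatorname{supp}(f)=\{x\in L: f(x)>0\}$. For $S\subseteq L$, the lattice closure of $S$ is the minimal sublattice of $\mathcal{L}$ containing $S$ (a sublattice is a subset closed under $\vee$ and $\wedge$). The direct product $\mathcal{L}_1\times\mathcal{L}_2$ of two lattices is the lattice on $L_1\times L_2$ with coordinatewise join and meet. One of the factors is allowed to be the trivial one-element lattice. Cross-factoring: four functions $a,b,c,d:L\to\mathbb{R}_{\ge0}$ cross-factor on a distributive lattice $\mathcal{L}=(L,\vee,\wedge)$ if there exist distributive lattices $\mathcal{L}_1=(L_1,\vee',\wedge')$ and $\mathcal{L}_2=(L_2,\vee'',\wedge'')$, functions $f_1,g_1:L_1\to\mathbb{R}_{\ge0}$ and $f_2,g_2:L_2\to\mathbb{R}_{\ge0}$, and positive constants $\alpha,\beta,\gamma,\delta>0$, such that $\mathcal{L}\simeq\mathcal{L}_1\times\mathcal{L}_2$, $\alpha\beta=\gamma\delta$,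 and (identifying $L$ with $L_1\times L_2$ via the isomorphism) $$a(x_1,x_2)=\alpha f_1(x_1)f_2(x_2),\quad b(x_1,x_2)=\beta g_1(x_1)g_2(x_2),$$ $$c(x_1,x_2)=\gamma f_1(x_1)g_2(x_2),\quad d(x_1,x_2)=\delta g_1(x_1)f_2(x_2)$$ for all $(x_1,x_2)\in L_1\times L_2$. *)

theory Defs
  imports Complex_Main
begin

text \<open>
  HOL cannot quantify existentially over types, so the two factors of a lattice, which are only
  asserted to exist, are lattices on a carrier set rather than instances of the type class
  \<^class>\<open>distrib_lattice\<close>.
\<close>

definition distrib_lattice_on :: "'a set \<Rightarrow> ('a \<Rightarrow> 'a \<Rightarrow> 'a) \<Rightarrow> ('a \<Rightarrow> 'a \<Rightarrow> 'a) \<Rightarrow> bool" where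
  "distrib_lattice_on A j m \<longleftrightarrow>
     (\<forall>x\<in>A. \<forall>y\<in>A. j x y \<in> A \<and> m x y \<in> A) \<and>
     (\<forall>x\<in>A. \<forall>y\<in>A. j x y = j y x \<and> m x y = m y x) \<and>
     (\<forall>x\<in>A. \<forall>y\<in>A. \<forall>z\<in>A. j (j x y) z = j x (j y z) \<and> m (m x y) z = m x (m y z)) \<and>
     (\<forall>x\<in>A. \<forall>y\<in>A. j x (m x y) = x \<and> m x (j x y) = x) \<and>
     (\<forall>x\<in>A. \<forall>y\<in>A. \<forall>z\<in>A. m x (j y z) = j (m x y) (m x z))"

definition prod_op :: "('a \<Rightarrow> 'a \<Rightarrow> 'a) \<Rightarrow> ('b \<Rightarrow> 'b \<Rightarrow> 'b) \<Rightarrow> 'a \<times> 'b \<Rightarrow> 'a \<times> 'b \<Rightarrow> 'a \<times> 'b" where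
  "prod_op s t p q = (s (fst p) (fst q), t (snd p) (snd q))"

definition lattice_iso ::
  "('a \<Rightarrow> 'b) \<Rightarrow> 'a set \<Rightarrow> ('a \<Rightarrow> 'a \<Rightarrow> 'a) \<Rightarrow> ('a \<Rightarrow> 'a \<Rightarrow> 'a) \<Rightarrow>
   'b set \<Rightarrow> ('b \<Rightarrow> 'b \<Rightarrow> 'b) \<Rightarrow> ('b \<Rightarrow> 'b \<Rightarrow> 'b) \<Rightarrow> bool" where
  "lattice_iso h A j m B j' m' \<longleftrightarrow>
     bij_betw h A B \<and>
     (\<forall>x\<in>A. \<forall>y\<in>A. h (j x y) = j' (h x) (h y) \<and> h (m x y) = m' (h x) (h y))"

definition sublattice :: "'a::lattice set \<Rightarrow> bool" where
  "sublattice S \<longleftrightarrow> (\<forall>x\<in>S. \<forall>y\<in>S. sup x y \<in> S \<and> inf x y \<in> S)"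

definition lattice_closure :: "'a::lattice set \<Rightarrow> 'a set" where
  "lattice_closure S = sublattice hull S"

definition supp :: "('a \<Rightarrow> real) \<Rightarrow> 'a set" where
  "supp f = {x. f x > 0}"

definition cross_factor_via ::
  "'b set \<Rightarrow> ('b \<Rightarrow> 'b \<Rightarrow> 'b) \<Rightarrow> ('b \<Rightarrow> 'b \<Rightarrow> 'b) \<Rightarrow>
   'c set \<Rightarrow> ('c \<Rightarrow> 'c \<Rightarrow> 'c) \<Rightarrow> ('c \<Rightarrow> 'c \<Rightarrow> 'c) \<Rightarrow>
   ('a::distrib_lattice \<Rightarrow> real) \<Rightarrow> ('a \<Rightarrow> real) \<Rightarrow> ('a \<Rightarrow> real) \<Rightarrow> ('a \<Rightarrow> real) \<Rightarrow> bool" where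
  "cross_factor_via L1 j1 m1 L2 j2 m2 a b c d \<longleftrightarrow>
     distrib_lattice_on L1 j1 m1 \<and> distrib_lattice_on L2 j2 m2 \<and>
     (\<exists>(h :: 'b \<times> 'c \<Rightarrow> 'a) (f1 :: 'b \<Rightarrow> real) (g1 :: 'b \<Rightarrow> real)
        (f2 :: 'c \<Rightarrow> real) (g2 :: 'c \<Rightarrow> real) (\<alpha>::real) (\<beta>::real) (\<gamma>::real) (\<delta>::real).
        lattice_iso h (L1 \<times> L2) (prod_op j1 j2) (prod_op m1 m2) UNIV sup inf \<and>
        (\<forall>x\<in>L1. f1 x \<ge> 0 \<and> g1 x \<ge> 0) \<and> (\<forall>x\<in>L2. f2 x \<ge> 0 \<and> g2 x \<ge> 0) \<and>
        \<alpha> > 0 \<and> \<beta> > 0 \<and> \<gamma> > 0 \<and> \<delta> > 0 \<and> \<alpha> * \<beta> = \<gamma> * \<delta> \<and>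
        (\<forall>x1\<in>L1. \<forall>x2\<in>L2.
           a (h (x1, x2)) = \<alpha> * f1 x1 * f2 x2 \<and>
           b (h (x1, x2)) = \<beta> * g1 x1 * g2 x2 \<and>
           c (h (x1, x2)) = \<gamma> * f1 x1 * g2 x2 \<and>
           d (h (x1, x2)) = \<delta> * g1 x1 * f2 x2))"

text \<open>
  Each factor of a (nonempty) lattice embeds into it, so it is no restriction to look for the
  carriers of the factors inside the type of the lattice itself: the lemma \<open>cross_factorI\<close> below
  shows that factors over arbitrary types yield the same notion.
\<close>

definition cross_factor ::
  "('a::distrib_lattice \<Rightarrow> real) \<Rightarrow> ('a \<Rightarrow> real) \<Rightarrow> ('a \<Rightarrow> real) \<Rightarrow> ('a \<Rightarrow> real) \<Rightarrow> bool" where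
  "cross_factor a b c d \<longleftrightarrow>
     (\<exists>(L1 :: 'a set) j1 m1 (L2 :: 'a set) j2 m2. cross_factor_via L1 j1 m1 L2 j2 m2 a b c d)"

lemma distrib_lattice_on_transport:
  assumes "distrib_lattice_on A j m" and "bij_betw k A' A"
  shows "distrib_lattice_on A' (\<lambda>x y. inv_into A' k (j (k x) (k y)))
           (\<lambda>x y. inv_into A' k (m (k x) (k y)))"
proof -
  have k: "k x \<in> A" if "x \<in> A'" for x
    using assms(2) that by (auto simp: bij_betw_def)
  have ki: "k (inv_into A' k y) = y" "inv_into A' k y \<in> A'" if "y \<in> A" for y
    using assms(2) that by (auto simp: bij_betw_def f_inv_into_f inv_into_into)
  have ik: "inv_into A' k (k x) = x" if "x \<in> A'" for x
    using assms(2) that by (auto simp: bij_betw_def)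
  show ?thesis
    unfolding distrib_lattice_on_def
  proof (intro conjI ballI)
    fix x y z
    assume z: "x \<in> A'" "y \<in> A'" "z \<in> A'"
    note ax = assms(1)[unfolded distrib_lattice_on_def]
    have cl: "j u v \<in> A" "m u v \<in> A" if "u \<in> A" "v \<in> A" for u v
      using ax that by blast+
    have "j (j (k x) (k y)) (k z) = j (k x) (j (k y) (k z))"
      and "m (m (k x) (k y)) (k z) = m (k x) (m (k y) (k z))"
      and "m (k x) (j (k y) (k z)) = j (m (k x) (k y)) (m (k x) (k z))"
      using ax z k by blast+
    then show "inv_into A' k (j (k (inv_into A' k (j (k x) (k y)))) (k z)) =
        inv_into A' k (j (k x) (k (inv_into A' k (j (k y) (k z)))))"
      and "inv_into A' k (m (k (inv_into A' k (m (k x) (k y)))) (k z)) =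
        inv_into A' k (m (k x) (k (inv_into A' k (m (k y) (k z)))))"
      and "inv_into A' k (m (k x) (k (inv_into A' k (j (k y) (k z))))) =
        inv_into A' k (j (k (inv_into A' k (m (k x) (k y)))) (k (inv_into A' k (m (k x) (k z)))))"
      using z by (simp_all add: k ki cl)
  qed (use assms(1) in \<open>simp_all add: distrib_lattice_on_def k ki ik\<close>)
qed

lemma cross_factorI:
  fixes a b c d :: "'a::distrib_lattice \<Rightarrow> real" and L1 :: "'b set" and L2 :: "'c set"
  assumes "cross_factor_via L1 j1 m1 L2 j2 m2 a b c d"
  shows "cross_factor a b c d"
proof -
  obtain h :: "'b \<times> 'c \<Rightarrow> 'a" and f1 g1 f2 g2 and \<alpha> \<beta> \<gamma> \<delta> :: real where
    L: "distrib_lattice_on L1 j1 m1" "distrib_lattice_on L2 j2 m2" and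
    h: "lattice_iso h (L1 \<times> L2) (prod_op j1 j2) (prod_op m1 m2) UNIV sup inf" and
    nn: "\<forall>x\<in>L1. f1 x \<ge> 0 \<and> g1 x \<ge> 0" "\<forall>x\<in>L2. f2 x \<ge> 0 \<and> g2 x \<ge> 0" and
    pos: "\<alpha> > 0" "\<beta> > 0" "\<gamma> > 0" "\<delta> > 0" "\<alpha> * \<beta> = \<gamma> * \<delta>" and
    eqs: "\<forall>x1\<in>L1. \<forall>x2\<in>L2.
           a (h (x1, x2)) = \<alpha> * f1 x1 * f2 x2 \<and> b (h (x1, x2)) = \<beta> * g1 x1 * g2 x2 \<and>
           c (h (x1, x2)) = \<gamma> * f1 x1 * g2 x2 \<and> d (h (x1, x2)) = \<delta> * g1 x1 * f2 x2"
    using assms unfolding cross_factor_via_def by metis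
  have bij: "bij_betw h (L1 \<times> L2) UNIV"
    using h by (simp add: lattice_iso_def)
  then have "L1 \<times> L2 \<noteq> {}"
    by (metis UNIV_not_empty bij_betw_empty1)
  then obtain p1 p2 where p: "p1 \<in> L1" "p2 \<in> L2" by auto
  have inj: "inj_on h (L1 \<times> L2)"
    using bij by (simp add: bij_betw_def)
  define e1 where "e1 = (\<lambda>x. h (x, p2))"
  define e2 where "e2 = (\<lambda>y. h (p1, y))"
  have "inj_on e1 L1" "inj_on e2 L2"
    using inj p by (auto simp: inj_on_def e1_def e2_def)
  then have e: "bij_betw e1 L1 (e1 ` L1)" "bij_betw e2 L2 (e2 ` L2)"
    by (simp_all add: bij_betw_def)
  define k1 where "k1 = inv_into L1 e1"
  define k2 where "k2 = inv_into L2 e2"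
  define M1 where "M1 = e1 ` L1"
  define M2 where "M2 = e2 ` L2"
  have kb: "bij_betw k1 M1 L1" "bij_betw k2 M2 L2"
    using e bij_betw_inv_into unfolding k1_def k2_def M1_def M2_def by blast+
  have k: "k1 x \<in> L1" "k2 y \<in> L2" if "x \<in> M1" "y \<in> M2" for x y
    using kb that by (auto simp: bij_betw_def)
  have ki1: "k1 (inv_into M1 k1 x) = x" if "x \<in> L1" for x
    using kb that by (auto simp: bij_betw_def f_inv_into_f)
  have ki2: "k2 (inv_into M2 k2 x) = x" if "x \<in> L2" for x
    using kb that by (auto simp: bij_betw_def f_inv_into_f)
  have cl: "\<forall>x\<in>L1. \<forall>y\<in>L1. j1 x y \<in> L1 \<and> m1 x y \<in> L1"
    "\<forall>x\<in>L2. \<forall>y\<in>L2. j2 x y \<in> L2 \<and> m2 x y \<in> L2"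
    using L by (auto simp: distrib_lattice_on_def)
  define J1 where "J1 = (\<lambda>x y. inv_into M1 k1 (j1 (k1 x) (k1 y)))"
  define J2 where "J2 = (\<lambda>x y. inv_into M2 k2 (j2 (k2 x) (k2 y)))"
  define N1 where "N1 = (\<lambda>x y. inv_into M1 k1 (m1 (k1 x) (k1 y)))"
  define N2 where "N2 = (\<lambda>x y. inv_into M2 k2 (m2 (k2 x) (k2 y)))"
  have L': "distrib_lattice_on M1 J1 N1" "distrib_lattice_on M2 J2 N2"
    unfolding J1_def N1_def J2_def N2_def
    using distrib_lattice_on_transport L kb by blast+
  define H where "H = h \<circ> map_prod k1 k2"
  have "bij_betw (map_prod k1 k2) (M1 \<times> M2) (L1 \<times> L2)"
    using kb by (rule bij_betw_map_prod)
  then have "bij_betw H (M1 \<times> M2) UNIV"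
    unfolding H_def using bij by (rule bij_betw_trans)
  moreover have "\<forall>x\<in>M1 \<times> M2. \<forall>y\<in>M1 \<times> M2. H (prod_op J1 J2 x y) = sup (H x) (H y) \<and>
      H (prod_op N1 N2 x y) = inf (H x) (H y)"
    using h cl
    by (auto simp: H_def lattice_iso_def prod_op_def J1_def J2_def N1_def N2_def ki1 ki2 k)
  ultimately have H: "lattice_iso H (M1 \<times> M2) (prod_op J1 J2) (prod_op N1 N2) UNIV sup inf"
    by (simp add: lattice_iso_def)
  have "cross_factor_via M1 J1 N1 M2 J2 N2 a b c d"
    unfolding cross_factor_via_def
    apply (intro conjI L')
    apply (rule exI[of _ H], rule exI[of _ "f1 \<circ> k1"], rule exI[of _ "g1 \<circ> k1"],
        rule exI[of _ "f2 \<circ> k2"], rule exI[of _ "g2 \<circ> k2"],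
        rule exI[of _ \<alpha>], rule exI[of _ \<beta>], rule exI[of _ \<gamma>], rule exI[of _ \<delta>])
    using H nn pos eqs kb by (auto simp: H_def bij_betw_def)
  then show ?thesis
    unfolding cross_factor_def by blast
qed

end

theory Submission
  imports Defs "HOL-Computational_Algebra.Polynomial"
begin

text \<open>
  The lattice embeds into the subsets of a finite set \<open>V\<close> of coordinates, its join-prime elements.
  Give every coordinate \<open>i\<close> a weight \<open>w i > 0\<close>. Multiplying all four functions by
  \<open>\<Prod>i\<in>X. w i\<close> preserves the hypothesis, because
  the multiset of coordinates of \<open>X\<close> and \<open>Y\<close> is that of \<open>X \<union> Y\<close> and \<open>X \<inter> Y\<close>; the sums become
  generating polynomials \<open>A\<close>, \<open>B\<close>, \<open>C\<close>, \<open>D\<close> in the weights, of degree at most one in each of them.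

  The first point is that equality of the sums propagates from the weights \<open>1\<close> to all positive
  weights (\<open>gen_equality_all_weights\<close>). Sum over all coordinates but one. The inequality left in the
  last coordinate is the sum of three valid inequalities, one for each power of its weight, so
  equality of the sums forces equality for each power, hence for every value of that weight. Now
  change the weights one after the other.

  So \<open>A * B = C * D\<close> as polynomials, and cross-factoring is the common refinement
  \<open>A = F1 * F2\<close>, \<open>B = G1 * G2\<close>, \<open>C = F1 * G2\<close>, \<open>D = G1 * F2\<close> of the two factorizations. Being of
  degree one in each variable, the factors of one product share no variable; hence the variables of
  \<open>F1\<close>, \<open>G1\<close> are separate from those of \<open>F2\<close>, \<open>G2\<close>, and on coefficients this is the required
  factorization of \<open>a\<close>, \<open>b\<close>, \<open>c\<close>, \<open>d\<close>. The refinement is found without unique factorization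
  (\<open>multiaffine_cross_factor\<close>): for each variable, \<open>A / C\<close> or \<open>A / D\<close> does not depend on it; let
  \<open>T\<close> collect the variables of the first kind. If \<open>i \<in> T\<close> and \<open>j \<notin> T\<close>, then \<open>log A\<close> has
  mixed derivative zero in the weights of \<open>i\<close> and \<open>j\<close>, so that \<open>A\<close> splits into a function of the weights
  in \<open>T\<close> and one of the others, and so do \<open>B\<close>, \<open>C\<close> and \<open>D\<close>.

  Finally the union of the four supports is a product set with respect to \<open>T\<close> and its complement.
  Being the lattice closure of that set, the lattice is a product as well (\<open>split_closed\<close>). If the
  products of the sums vanish, two of the functions are zero, and one factor can be taken trivial
  (\<open>equality_imp_cross_factor_zero\<close>).
\<close>

section \<open>The four functions inequality on a power set\<close>

text \<open>
  With \<open>m = c1 * d0\<close>, \<open>p = a0 * b1\<close>, \<open>q = a1 * b0\<close> the hypotheses give \<open>p, q \<le> m\<close> and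
  \<open>p * q \<le> m * (c0 * d1)\<close>, and the claim is \<open>(m - p) * (m - q) \<ge> 0\<close> divided by \<open>m\<close>. The inequality
  concerns the mixed terms alone: this is why equality of the sums can later be split by degree.
\<close>

lemma two_point_mixed_terms:
  fixes a0 a1 b0 b1 c0 c1 d0 d1 :: real
  assumes nonneg: "a0 \<ge> 0" "a1 \<ge> 0" "b0 \<ge> 0" "b1 \<ge> 0" "c0 \<ge> 0" "c1 \<ge> 0" "d0 \<ge> 0" "d1 \<ge> 0"
    and le00: "a0 * b0 \<le> c0 * d0" and le01: "a0 * b1 \<le> c1 * d0"
    and le10: "a1 * b0 \<le> c1 * d0" and le11: "a1 * b1 \<le> c1 * d1"
  shows "a0 * b1 + a1 * b0 \<le> c0 * d1 + c1 * d0"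
proof (cases "c1 * d0 = 0")
  case True
  then have "a0 * b1 \<le> 0" "a1 * b0 \<le> 0"
    using le01 le10 by linarith+
  moreover have "c0 * d1 \<ge> 0"
    using nonneg by simp
  ultimately show ?thesis
    using True by linarith
next
  case False
  define m p q where "m = c1 * d0" and "p = a0 * b1" and "q = a1 * b0"
  have m: "m > 0"
    using False nonneg unfolding m_def by (metis less_eq_real_def mult_nonneg_nonneg)
  have "p * q = (a0 * b0) * (a1 * b1)"
    by (simp add: p_def q_def)
  also have "\<dots> \<le> (c0 * d0) * (c1 * d1)"
    using le00 le11 nonneg by (intro mult_mono[OF le00 le11]) auto
  finally have "p * q \<le> m * (c0 * d1)"
    by (simp add: m_def mult.commute mult.left_commute)
  moreover have "(m - p) * (m - q) \<ge> 0"
    using le01 le10 by (intro mult_nonneg_nonneg) (auto simp: m_def p_def q_def)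
  ultimately have "m * (p + q) \<le> m * (c0 * d1 + m)"
    by (simp add: algebra_simps)
  then show ?thesis
    using m unfolding m_def p_def q_def by (metis mult_le_cancel_left_pos)
qed

definition four_fun :: "'v set \<Rightarrow> ('v set \<Rightarrow> real) \<Rightarrow> ('v set \<Rightarrow> real) \<Rightarrow>
    ('v set \<Rightarrow> real) \<Rightarrow> ('v set \<Rightarrow> real) \<Rightarrow> bool" where
  "four_fun V a b c d \<longleftrightarrow>
     (\<forall>X. a X \<ge> 0 \<and> b X \<ge> 0 \<and> c X \<ge> 0 \<and> d X \<ge> 0) \<and>
     (\<forall>X\<subseteq>V. \<forall>Y\<subseteq>V. a X * b Y \<le> c (X \<union> Y) * d (X \<inter> Y))"

lemma sum_Pow_insert:
  fixes f :: "'v set \<Rightarrow> real"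
  assumes "finite V" "v \<notin> V"
  shows "sum f (Pow (insert v V)) = sum f (Pow V) + (\<Sum>X\<in>Pow V. f (insert v X))"
proof -
  have inj: "inj_on (insert v) (Pow V)"
    using assms(2) by (auto simp: inj_on_def)
  have "sum f (Pow (insert v V)) = sum f (Pow V) + sum f (insert v ` Pow V)"
    unfolding Pow_insert using assms by (intro sum.union_disjoint) auto
  then show ?thesis
    by (simp add: sum.reindex[OF inj])
qed

text \<open>One statement for each choice of which of the two sets contain \<open>v\<close>.\<close>

lemma four_fun_sections:
  assumes "four_fun (insert v V) a b c d" "v \<notin> V"
  shows "four_fun V a b c d"
    and "four_fun V a (b \<circ> insert v) (c \<circ> insert v) d"
    and "four_fun V (a \<circ> insert v) b (c \<circ> insert v) d"
    and "four_fun V (a \<circ> insert v) (b \<circ> insert v) (c \<circ> insert v) (d \<circ> insert v)"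
proof -
  have nn: "\<forall>X. a X \<ge> 0 \<and> b X \<ge> 0 \<and> c X \<ge> 0 \<and> d X \<ge> 0"
    and le: "a X * b Y \<le> c (X \<union> Y) * d (X \<inter> Y)"
    if "X \<subseteq> insert v V" "Y \<subseteq> insert v V" for X Y
    using assms(1) that by (auto simp: four_fun_def)
  have le00: "a X * b Y \<le> c (X \<union> Y) * d (X \<inter> Y)"
    and le01: "a X * b (insert v Y) \<le> c (insert v (X \<union> Y)) * d (X \<inter> Y)"
    and le10: "a (insert v X) * b Y \<le> c (insert v (X \<union> Y)) * d (X \<inter> Y)"
    and le11: "a (insert v X) * b (insert v Y) \<le> c (insert v (X \<union> Y)) * d (insert v (X \<inter> Y))"
    if "X \<subseteq> V" "Y \<subseteq> V" for X Y
  proof -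
    have "X \<inter> insert v Y = X \<inter> Y" "insert v X \<inter> Y = X \<inter> Y"
      using that assms(2) by auto
    then show "a X * b Y \<le> c (X \<union> Y) * d (X \<inter> Y)"
      "a X * b (insert v Y) \<le> c (insert v (X \<union> Y)) * d (X \<inter> Y)"
      "a (insert v X) * b Y \<le> c (insert v (X \<union> Y)) * d (X \<inter> Y)"
      "a (insert v X) * b (insert v Y) \<le> c (insert v (X \<union> Y)) * d (insert v (X \<inter> Y))"
      using le[of X Y] le[of X "insert v Y"] le[of "insert v X" Y] le[of "insert v X" "insert v Y"] that
      by (auto simp: subset_insertI2)
  qed
  show "four_fun V a b c d"
    and "four_fun V a (b \<circ> insert v) (c \<circ> insert v) d"
    and "four_fun V (a \<circ> insert v) b (c \<circ> insert v) d"
    and "four_fun V (a \<circ> insert v) (b \<circ> insert v) (c \<circ> insert v) (d \<circ> insert v)"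
    using nn le00 le01 le10 le11 by (auto simp: four_fun_def)
qed

text \<open>
  Summing out one coordinate preserves the hypothesis: that is the two-point case, whose three
  inequalities (both sets without \<open>v\<close>, one with \<open>v\<close>, both with \<open>v\<close>) add up.
\<close>

theorem ahlswede_daykin_Pow:
  assumes "finite V" "four_fun V a b c d"
  shows "sum a (Pow V) * sum b (Pow V) \<le> sum c (Pow V) * sum d (Pow V)"
  using assms
proof (induction V arbitrary: a b c d rule: finite_induct)
  case empty
  then show ?case
    by (auto simp: four_fun_def dest: spec[of _ "{}"])
next
  case (insert v V)
  note S = four_fun_sections[OF insert.prems insert.hyps(2)]
  have "four_fun V (\<lambda>X. a X + a (insert v X)) (\<lambda>X. b X + b (insert v X))
      (\<lambda>X. c X + c (insert v X)) (\<lambda>X. d X + d (insert v X))"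
    unfolding four_fun_def
  proof (intro conjI allI impI)
    fix X Y assume XY: "X \<subseteq> V" "Y \<subseteq> V"
    have le: "a X * b Y \<le> c (X \<union> Y) * d (X \<inter> Y)"
      "a X * b (insert v Y) \<le> c (insert v (X \<union> Y)) * d (X \<inter> Y)"
      "a (insert v X) * b Y \<le> c (insert v (X \<union> Y)) * d (X \<inter> Y)"
      "a (insert v X) * b (insert v Y) \<le> c (insert v (X \<union> Y)) * d (insert v (X \<inter> Y))"
      using S XY by (simp_all add: four_fun_def)
    have "a X * b (insert v Y) + a (insert v X) * b Y \<le>
        c (X \<union> Y) * d (insert v (X \<inter> Y)) + c (insert v (X \<union> Y)) * d (X \<inter> Y)"
      by (rule two_point_mixed_terms[OF _ _ _ _ _ _ _ _ le])
        (use insert.prems in \<open>simp_all add: four_fun_def\<close>)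
    then show "(a X + a (insert v X)) * (b Y + b (insert v Y)) \<le>
        (c (X \<union> Y) + c (insert v (X \<union> Y))) * (d (X \<inter> Y) + d (insert v (X \<inter> Y)))"
      using le(1,4) by (simp add: algebra_simps)
  qed (use insert.prems in \<open>simp_all add: four_fun_def\<close>)
  from insert.IH[OF this] show ?case
    by (simp add: sum_Pow_insert[OF insert.hyps] sum.distrib)
qed

section \<open>Equality propagates to all positive weights\<close>

text \<open>
  The generating polynomial of \<open>a\<close>, as a function of the weights of the coordinates.
\<close>

definition gen :: "'v set \<Rightarrow> ('v set \<Rightarrow> real) \<Rightarrow> ('v \<Rightarrow> real) \<Rightarrow> real" where
  "gen V a w = (\<Sum>X\<in>Pow V. a X * prod w X)"

definition positive :: "('v \<Rightarrow> real) \<Rightarrow> bool" where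
  "positive w \<longleftrightarrow> (\<forall>i. w i > 0)"

lemma positive_upd: "positive w \<Longrightarrow> t > 0 \<Longrightarrow> positive (w(i := t))"
  by (auto simp: positive_def)

lemma gen_insert:
  assumes "finite V" "v \<notin> V"
  shows "gen (insert v V) a w = gen V a w + w v * gen V (a \<circ> insert v) w"
proof -
  have "(\<Sum>X\<in>Pow V. a (insert v X) * prod w (insert v X)) =
      (\<Sum>X\<in>Pow V. w v * (a (insert v X) * prod w X))"
  proof (rule sum.cong[OF refl])
    fix X assume "X \<in> Pow V"
    then have "finite X" "v \<notin> X"
      using assms finite_subset by auto
    then show "a (insert v X) * prod w (insert v X) = w v * (a (insert v X) * prod w X)"
      by simp
  qed
  then show ?thesis
    by (simp add: gen_def sum_Pow_insert[OF assms] sum_distrib_left)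
qed

lemma gen_upd_outside:
  assumes "v \<notin> V"
  shows "gen V a (w(v := t)) = gen V a w"
  unfolding gen_def
proof (rule sum.cong[OF refl])
  fix X assume "X \<in> Pow V"
  then have "prod (w(v := t)) X = prod w X"
    using assms by (intro prod.cong) auto
  then show "a X * prod (w(v := t)) X = a X * prod w X"
    by simp
qed

lemma four_fun_weighted:
  assumes "finite V" "four_fun V a b c d" "positive w"
  shows "four_fun V (\<lambda>X. a X * prod w X) (\<lambda>X. b X * prod w X)
    (\<lambda>X. c X * prod w X) (\<lambda>X. d X * prod w X)"
proof -
  have pos: "prod w X \<ge> 0" for X
    using assms(3) by (intro prod_nonneg) (simp add: positive_def less_imp_le)
  have "(a X * prod w X) * (b Y * prod w Y) \<le>
      (c (X \<union> Y) * prod w (X \<union> Y)) * (d (X \<inter> Y) * prod w (X \<inter> Y))"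
    if "X \<subseteq> V" "Y \<subseteq> V" for X Y
  proof -
    have "finite X" "finite Y"
      using that assms(1) finite_subset by auto
    then have *: "prod w (X \<union> Y) * prod w (X \<inter> Y) = prod w X * prod w Y"
      by (rule prod.union_inter)
    have "(a X * b Y) * (prod w X * prod w Y) \<le>
        (c (X \<union> Y) * d (X \<inter> Y)) * (prod w (X \<union> Y) * prod w (X \<inter> Y))"
      unfolding * using assms(2) that by (intro mult_right_mono) (auto simp: four_fun_def pos)
    then show ?thesis
      by (simp add: mult_ac)
  qed
  then show ?thesis
    using assms(2) pos by (auto simp: four_fun_def)
qed

lemma gen_mult_le:
  assumes "finite V" "four_fun V a b c d" "positive w"
  shows "gen V a w * gen V b w \<le> gen V c w * gen V d w"
  unfolding gen_def by (rule ahlswede_daykin_Pow[OF assms(1) four_fun_weighted[OF assms]])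

lemma gen_nonneg:
  assumes "\<And>X. a X \<ge> 0" "positive w"
  shows "gen V a w \<ge> 0"
  unfolding gen_def using assms
  by (intro sum_nonneg mult_nonneg_nonneg prod_nonneg) (auto simp: positive_def less_imp_le)

text \<open>
  As polynomials in the weight \<open>z\<close> of \<open>v\<close>, both products have degree two, and for each of the three
  coefficients the inequality \<open>\<le>\<close> holds. Since \<open>z > 0\<close>, equality at one value of \<open>z\<close> makes all three
  equalities.
\<close>

lemma gen_equality_upd:
  assumes "finite V" "four_fun V a b c d" "positive w"
    and eq: "gen V a w * gen V b w = gen V c w * gen V d w" and "t > 0"
  shows "gen V a (w(v := t)) * gen V b (w(v := t)) = gen V c (w(v := t)) * gen V d (w(v := t))"
proof (cases "v \<in> V")
  case False
  then show ?thesis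
    by (simp add: gen_upd_outside eq)
next
  case True
  define U where "U = V - {v}"
  have U: "finite U" "v \<notin> U" "V = insert v U"
    using assms(1) True by (auto simp: U_def)
  note S = four_fun_sections[OF assms(2)[unfolded U(3)] U(2)]
  note le = S[THEN gen_mult_le[OF U(1) _ assms(3)]]
  define a0 a1 b0 b1 c0 c1 d0 d1 where
    "a0 = gen U a w" and "a1 = gen U (a \<circ> insert v) w" and
    "b0 = gen U b w" and "b1 = gen U (b \<circ> insert v) w" and
    "c0 = gen U c w" and "c1 = gen U (c \<circ> insert v) w" and
    "d0 = gen U d w" and "d1 = gen U (d \<circ> insert v) w"
  note defs = a0_def a1_def b0_def b1_def c0_def c1_def d0_def d1_def
  have mixed: "a0 * b1 + a1 * b0 \<le> c0 * d1 + c1 * d0"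
    unfolding defs
    by (rule two_point_mixed_terms[OF _ _ _ _ _ _ _ _ le])
      (use assms(2,3) in \<open>auto simp: four_fun_def intro!: gen_nonneg\<close>)
  have le00: "a0 * b0 \<le> c0 * d0" and le11: "a1 * b1 \<le> c1 * d1"
    using le(1,4) by (simp_all add: defs)
  have exp: "gen V a (w(v := s)) * gen V b (w(v := s)) = a0 * b0 + s * (a0 * b1 + a1 * b0) + s^2 * (a1 * b1)"
    "gen V c (w(v := s)) * gen V d (w(v := s)) = c0 * d0 + s * (c0 * d1 + c1 * d0) + s^2 * (c1 * d1)" for s
    by (simp_all add: U(3) gen_insert[OF U(1,2)] gen_upd_outside[OF U(2)] defs
        power2_eq_square algebra_simps)
  define z where "z = w v"
  have z: "z > 0"
    using assms(3) by (simp add: z_def positive_def)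
  have "a0 * b0 + z * (a0 * b1 + a1 * b0) + z^2 * (a1 * b1) =
      c0 * d0 + z * (c0 * d1 + c1 * d0) + z^2 * (c1 * d1)"
    using exp[of z] eq by (simp add: z_def)
  moreover have "z * (a0 * b1 + a1 * b0) \<le> z * (c0 * d1 + c1 * d0)"
    "z^2 * (a1 * b1) \<le> z^2 * (c1 * d1)"
    using z mixed le11 by simp_all
  ultimately have "a0 * b0 = c0 * d0" "z * (a0 * b1 + a1 * b0) = z * (c0 * d1 + c1 * d0)"
    "z^2 * (a1 * b1) = z^2 * (c1 * d1)"
    using le00 by linarith+
  then have "a0 * b0 = c0 * d0" "a0 * b1 + a1 * b0 = c0 * d1 + c1 * d0" "a1 * b1 = c1 * d1"
    using z by auto
  then show ?thesis
    unfolding exp by simp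
qed

theorem gen_equality_all_weights:
  fixes a b c d :: "'v::finite set \<Rightarrow> real"
  assumes "four_fun UNIV a b c d"
    and "sum a UNIV * sum b UNIV = sum c UNIV * sum d UNIV"
    and w: "positive w"
  shows "gen UNIV a w * gen UNIV b w = gen UNIV c w * gen UNIV d w"
proof -
  \<comment> \<open>Starting from the weights \<open>1\<close>, put in the weights \<open>w i\<close> one coordinate after the other.\<close>
  have "gen UNIV a v * gen UNIV b v = gen UNIV c v * gen UNIV d v"
    if "v = (\<lambda>i. if i \<in> S then w i else 1)" for S v
    using finite[of S] that
  proof (induction S arbitrary: v rule: finite_induct)
    case empty
    then show ?case
      using assms(2) by (simp add: gen_def)
  next
    case (insert i S)
    define v' where "v' = (\<lambda>j. if j \<in> S then w j else 1)"
    have "v = v'(i := w i)"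
      using insert.prems by (auto simp: v'_def)
    moreover have "positive v'" "w i > 0"
      using w by (auto simp: positive_def v'_def)
    ultimately show ?case
      using gen_equality_upd[OF finite assms(1) _ insert.IH[OF v'_def]] by metis
  qed
  from this[of w UNIV] show ?thesis
    by simp
qed

section \<open>Multiaffine functions with equal products\<close>

text \<open>
  Being a polynomial along every line is all that is needed of polynomials in several variables: it
  is preserved by the ring operations and by fixing a variable, and it makes the ring an integral
  domain (\<open>line_poly_mult_eq_0\<close>).
\<close>

definition line_poly :: "(('v \<Rightarrow> real) \<Rightarrow> real) \<Rightarrow> bool" where
  "line_poly F \<longleftrightarrow> (\<forall>u w. \<exists>p. \<forall>t. F (\<lambda>i. u i + t * w i) = poly p t)"

lemma line_poly_mult:
  assumes "line_poly F" "line_poly H"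
  shows "line_poly (\<lambda>w. F w * H w)"
  unfolding line_poly_def
proof (intro allI)
  fix u w
  obtain p q where "\<forall>t. F (\<lambda>i. u i + t * w i) = poly p t" "\<forall>t. H (\<lambda>i. u i + t * w i) = poly q t"
    using assms unfolding line_poly_def by metis
  then show "\<exists>p. \<forall>t. F (\<lambda>i. u i + t * w i) * H (\<lambda>i. u i + t * w i) = poly p t"
    by (intro exI[of _ "p * q"]) simp
qed

lemma line_poly_diff:
  assumes "line_poly F" "line_poly H"
  shows "line_poly (\<lambda>w. F w - H w)"
  unfolding line_poly_def
proof (intro allI)
  fix u w
  obtain p q where "\<forall>t. F (\<lambda>i. u i + t * w i) = poly p t" "\<forall>t. H (\<lambda>i. u i + t * w i) = poly q t"
    using assms unfolding line_poly_def by metis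
  then show "\<exists>p. \<forall>t. F (\<lambda>i. u i + t * w i) - H (\<lambda>i. u i + t * w i) = poly p t"
    by (intro exI[of _ "p - q"]) simp
qed

lemma line_poly_upd:
  assumes "line_poly F"
  shows "line_poly (\<lambda>w. F (w(i := s)))"
  unfolding line_poly_def
proof (intro allI)
  fix u w
  obtain p where p: "\<forall>t. F (\<lambda>j. (u(i := s)) j + t * (w(i := 0)) j) = poly p t"
    using assms unfolding line_poly_def by metis
  have "(\<lambda>j. u j + t * w j)(i := s) = (\<lambda>j. (u(i := s)) j + t * (w(i := 0)) j)" for t
    by auto
  then show "\<exists>p. \<forall>t. F ((\<lambda>j. u j + t * w j)(i := s)) = poly p t"
    using p by metis
qed

text \<open>
  If \<open>F\<close> is nonzero at \<open>u\<close> and \<open>H\<close> at \<open>v\<close>, then on the line through \<open>u\<close> and \<open>v\<close> both are nonzero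
  polynomials in one variable, whose product has only finitely many zeros. The segment from \<open>u\<close> to
  \<open>v\<close> consists of positive weights, as these form a convex set.
\<close>

lemma line_poly_mult_eq_0:
  assumes F: "line_poly F" and H: "line_poly H"
    and zero: "\<And>w. positive w \<Longrightarrow> F w * H w = 0"
  shows "(\<forall>w. positive w \<longrightarrow> F w = 0) \<or> (\<forall>w. positive w \<longrightarrow> H w = 0)"
proof (rule ccontr)
  assume "\<not> ?thesis"
  then obtain u v where u: "positive u" "F u \<noteq> 0" and v: "positive v" "H v \<noteq> 0"
    by auto
  obtain p where p: "\<And>t. F (\<lambda>i. u i + t * (v i - u i)) = poly p t"
    using F unfolding line_poly_def by metis
  obtain q where q: "\<And>t. H (\<lambda>i. u i + t * (v i - u i)) = poly q t"
    using H unfolding line_poly_def by metis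
  have "poly p 0 \<noteq> 0" "poly q 1 \<noteq> 0"
    using p[of 0] q[of 1] u v by simp_all
  then have "p * q \<noteq> 0"
    by auto
  have "poly (p * q) t = 0" if "t \<in> {0..1}" for t
  proof -
    have "u i + t * (v i - u i) > 0" for i
    proof -
      have "u i + t * (v i - u i) = (1 - t) * u i + t * v i"
        by (simp add: algebra_simps)
      moreover have "(1 - t) * u i + t * v i > 0"
      proof (cases "t = 0")
        case True
        then show ?thesis
          using u(1) by (simp add: positive_def)
      next
        case False
        moreover have "(1 - t) * u i \<ge> 0"
          using that u(1) by (simp add: positive_def less_imp_le)
        ultimately show ?thesis
          using that v(1) by (intro add_nonneg_pos) (simp_all add: positive_def)
      qed
      ultimately show ?thesis
        by simp
    qed
    then have "F (\<lambda>i. u i + t * (v i - u i)) * H (\<lambda>i. u i + t * (v i - u i)) = 0"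
      by (intro zero) (simp add: positive_def)
    then show ?thesis
      by (simp add: p q)
  qed
  then have "{0..1} \<subseteq> {t. poly (p * q) t = 0}"
    by blast
  then have "finite {0..1::real}"
    using poly_roots_finite[OF \<open>p * q \<noteq> 0\<close>] finite_subset by blast
  moreover have "infinite {0..1::real}"
    by (rule infinite_Icc) simp
  ultimately show False
    by contradiction
qed

text \<open>
  Affine dependence on a variable is expressed by interpolation between the values \<open>1\<close> and \<open>2\<close>, so
  that it can be used where identities between the functions are known for positive weights only.
\<close>

definition multiaffine :: "(('v \<Rightarrow> real) \<Rightarrow> real) \<Rightarrow> bool" where
  "multiaffine F \<longleftrightarrow> line_poly F \<and>
     (\<forall>i w t. F (w(i := t)) = (2 - t) * F (w(i := 1)) + (t - 1) * F (w(i := 2)))"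

lemma multiaffine_upd:
  "multiaffine F \<Longrightarrow> F (w(i := t)) = (2 - t) * F (w(i := 1)) + (t - 1) * F (w(i := 2))"
  unfolding multiaffine_def by blast

lemma multiaffine_upd3:
  assumes "multiaffine F"
  shows "F (w(i := 3)) = 2 * F (w(i := 2)) - F (w(i := 1))"
  using multiaffine_upd[OF assms, of w i 3] by simp

lemma multiaffine_line_poly: "multiaffine F \<Longrightarrow> line_poly F"
  by (simp add: multiaffine_def)

lemma multiaffine_gen:
  assumes "finite V"
  shows "multiaffine (gen V a)"
  unfolding multiaffine_def
proof (intro conjI allI)
  show "line_poly (gen V a)"
    unfolding line_poly_def
  proof (intro allI)
    fix u w :: "'a \<Rightarrow> real"
    show "\<exists>p. \<forall>t. gen V a (\<lambda>i. u i + t * w i) = poly p t"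
      by (intro exI[of _ "\<Sum>X\<in>Pow V. smult (a X) (\<Prod>i\<in>X. [:u i, w i:])"])
        (simp add: gen_def poly_sum poly_prod)
  qed
next
  fix i :: 'a and w t
  show "gen V a (w(i := t)) = (2 - t) * gen V a (w(i := 1)) + (t - 1) * gen V a (w(i := 2))"
  proof (cases "i \<in> V")
    case False
    then show ?thesis
      by (simp add: gen_upd_outside algebra_simps)
  next
    case True
    define U where "U = V - {i}"
    have U: "finite U" "i \<notin> U" "V = insert i U"
      using assms True by (auto simp: U_def)
    show ?thesis
      by (simp add: U(3) gen_insert[OF U(1,2)] gen_upd_outside[OF U(2)] algebra_simps)
  qed
qed

text \<open>
  Comparing \<open>F / H\<close> at two values of the variable \<open>i\<close> is enough: if it agrees there, then for
  multiaffine functions it does not depend on \<open>i\<close> at all (\<open>ratio_free_upd\<close>).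
\<close>

definition ratio_free :: "'v \<Rightarrow> (('v \<Rightarrow> real) \<Rightarrow> real) \<Rightarrow> (('v \<Rightarrow> real) \<Rightarrow> real) \<Rightarrow> bool" where
  "ratio_free i F H \<longleftrightarrow>
     (\<forall>w. positive w \<longrightarrow> F (w(i := 1)) * H (w(i := 2)) = F (w(i := 2)) * H (w(i := 1)))"

lemma ratio_free_upd:
  assumes F: "multiaffine F" and H: "multiaffine H" and "ratio_free i F H" "positive w"
  shows "F w * H (w(i := t)) = F (w(i := t)) * H w"
proof -
  have *: "F (w(i := 1)) * H (w(i := 2)) = F (w(i := 2)) * H (w(i := 1))"
    using assms(3,4) unfolding ratio_free_def by blast
  have "F (w(i := s)) * H (w(i := t)) = F (w(i := t)) * H (w(i := s))" for s
    using * unfolding multiaffine_upd[OF F, of w i s] multiaffine_upd[OF F, of w i t]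
      multiaffine_upd[OF H, of w i s] multiaffine_upd[OF H, of w i t]
    by algebra
  from this[of "w i"] show ?thesis
    by simp
qed

text \<open>
  In the variable \<open>i\<close>, the identity \<open>A * B = C * D\<close> equates two products of linear polynomials, so
  \<open>A\<close> has the same root as \<open>C\<close> or as \<open>D\<close>; hence the product of the two corresponding \<open>2 \<times> 2\<close>
  determinants vanishes for all values of the other variables. One of the determinants then vanishes
  identically.
\<close>

lemma ratio_free_dichotomy:
  assumes A: "multiaffine A" and B: "multiaffine B" and C: "multiaffine C" and D: "multiaffine D"
    and eq: "\<And>w. positive w \<Longrightarrow> A w * B w = C w * D w"
  shows "ratio_free i A C \<or> ratio_free i A D"
proof -
  have "(A (w(i := 1)) * C (w(i := 2)) - A (w(i := 2)) * C (w(i := 1))) *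
      (A (w(i := 1)) * D (w(i := 2)) - A (w(i := 2)) * D (w(i := 1))) = 0" if "positive w" for w
  proof -
    define A1 A2 B1 B2 C1 C2 D1 D2 where
      "A1 = A (w(i := 1))" and "A2 = A (w(i := 2))" and
      "B1 = B (w(i := 1))" and "B2 = B (w(i := 2))" and
      "C1 = C (w(i := 1))" and "C2 = C (w(i := 2))" and
      "D1 = D (w(i := 1))" and "D2 = D (w(i := 2))"
    note defs = A1_def A2_def B1_def B2_def C1_def C2_def D1_def D2_def
    \<comment> \<open>The third value of the variable is what isolates the mixed terms.\<close>
    have e: "A1 * B1 = C1 * D1" "A2 * B2 = C2 * D2"
      "(2 * A2 - A1) * (2 * B2 - B1) = (2 * C2 - C1) * (2 * D2 - D1)"
      using eq[of "w(i := 1)"] eq[of "w(i := 2)"] eq[of "w(i := 3)"] that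
      by (simp_all add: defs positive_upd multiaffine_upd3 A B C D)
    then have m: "A1 * B2 + A2 * B1 = C1 * D2 + C2 * D1"
      by (simp add: algebra_simps)
    have "(A1 * C2 - A2 * C1) * (A1 * D2 - A2 * D1) =
        A1 * A1 * (C2 * D2) - A1 * A2 * (C1 * D2 + C2 * D1) + A2 * A2 * (C1 * D1)"
      by (simp add: algebra_simps)
    also have "\<dots> = 0"
      unfolding e(1,2)[symmetric] m[symmetric] by (simp add: algebra_simps)
    finally show ?thesis
      by (simp add: defs)
  qed
  from line_poly_mult_eq_0[OF _ _ this] show ?thesis
    using A C D unfolding ratio_free_def
    by (force intro: line_poly_diff line_poly_mult line_poly_upd multiaffine_line_poly)
qed

text \<open>
  As \<open>A / C\<close> does not depend on \<open>i\<close>, the mixed derivatives of \<open>log A\<close> and \<open>log C\<close> in \<open>i\<close> and \<open>j\<close>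
  agree. For a multiaffine function that derivative is a mixed determinant, which involves neither
  \<open>i\<close> nor \<open>j\<close>, divided by the square of the function. So wherever the determinant of \<open>A\<close> is nonzero,
  \<open>(A / C)\<^sup>2\<close> is free of \<open>j\<close>. The product of the determinant with \<open>R\<close>, which measures how
  \<open>A / C\<close> depends on \<open>j\<close>, therefore vanishes, and \<open>R\<close> is not identically zero. The proof checks
  this product by polynomial identities in the four corner values of \<open>A\<close> and of \<open>C\<close>.
\<close>

lemma mixed_difference_vanishes:
  assumes A: "multiaffine A" and C: "multiaffine C" and "i \<noteq> j"
    and i: "ratio_free i A C" and j: "\<not> ratio_free j A C" and w: "positive w"
  shows "A (w(i := 1, j := 1)) * A (w(i := 2, j := 2)) = A (w(i := 1, j := 2)) * A (w(i := 2, j := 1))"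
proof -
  define \<Delta> where "\<Delta> = (\<lambda>w. A (w(i := 1, j := 1)) * A (w(i := 2, j := 2))
      - A (w(i := 1, j := 2)) * A (w(i := 2, j := 1)))"
  define R where "R = (\<lambda>w. A (w(j := 1)) * C (w(j := 2)) - A (w(j := 2)) * C (w(j := 1)))"
  have "\<Delta> w * R w = 0" if "positive w" for w
  proof -
    define p q r s p' q' r' s' where
      "p = A (w(i := 1, j := 1))" and "q = A (w(i := 2, j := 1))" and
      "r = A (w(i := 1, j := 2))" and "s = A (w(i := 2, j := 2))" and
      "p' = C (w(i := 1, j := 1))" and "q' = C (w(i := 2, j := 1))" and
      "r' = C (w(i := 1, j := 2))" and "s' = C (w(i := 2, j := 2))"
    note defs = p_def q_def r_def s_def p'_def q'_def r'_def s'_def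
    have tw: "w(j := t, i := u) = w(i := u, j := t)" for t u
      using \<open>i \<noteq> j\<close> by (rule fun_upd_twist[symmetric])
    have e: "A (w(i := 1, j := t)) * C (w(i := 2, j := t)) = A (w(i := 2, j := t)) * C (w(i := 1, j := t))"
      if "t > 0" for t
      using i \<open>positive w\<close> that unfolding ratio_free_def tw[symmetric]
      by (metis positive_upd)
    have e1: "p * q' = q * p'" and e2: "r * s' = s * r'"
      using e[of 1] e[of 2] by (simp_all add: defs)
    have "(2 * r - p) * (2 * s' - q') = (2 * s - q) * (2 * r' - p')"
      using e[of 3] by (simp add: defs multiaffine_upd3 A C)
    then have e3: "p * s' + r * q' = q * r' + s * p'"
      using e1 e2 by (simp add: algebra_simps)
    define x where "x = w i"
    have Aw: "A (w(j := t)) = (2 - x) * A (w(i := 1, j := t)) + (x - 1) * A (w(i := 2, j := t))" for t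
      using multiaffine_upd[OF A, of "w(j := t)" i x] \<open>i \<noteq> j\<close> tw by (simp add: x_def)
    have Cw: "C (w(j := t)) = (2 - x) * C (w(i := 1, j := t)) + (x - 1) * C (w(i := 2, j := t))" for t
      using multiaffine_upd[OF C, of "w(j := t)" i x] \<open>i \<noteq> j\<close> tw by (simp add: x_def)
    \<comment> \<open>Each coefficient of \<open>R\<close>, as a quadratic form in \<open>2 - x\<close> and \<open>x - 1\<close>, is annihilated by
      the determinant.\<close>
    have k1: "(p * s - r * q) * (p * r' - r * p') = 0"
    proof -
      have "(p * s - r * q) * (p * r' - r * p') =
          p * r * (p * s' + r * q' - q * r' - s * p') - p * p * (r * s' - s * r') - r * r * (p * q' - q * p')"
        by (simp add: algebra_simps)
      then show ?thesis
        using e1 e2 e3 by simp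
    qed
    have k2: "(p * s - r * q) * (q * s' - s * q') = 0"
    proof -
      have "(p * s - r * q) * (q * s' - s * q') =
          q * s * (p * s' + r * q' - q * r' - s * p') - q * q * (r * s' - s * r') - s * s * (p * q' - q * p')"
        by (simp add: algebra_simps)
      then show ?thesis
        using e1 e2 e3 by simp
    qed
    have k3: "(p * s - r * q) * (p * s' + q * r' - r * q' - s * p') = 0"
    proof -
      have "(p * s - r * q) * (p * s' + q * r' - r * q' - s * p') =
          (p * s + r * q) * (p * s' + r * q' - q * r' - s * p')
          - 2 * (p * q * (r * s' - s * r') + r * s * (p * q' - q * p'))"
        by (simp add: algebra_simps)
      then show ?thesis
        using e1 e2 e3 by simp
    qed
    have "(p * s - r * q) * ((u * p + v * q) * (u * r' + v * s') - (u * r + v * s) * (u * p' + v * q')) =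
        u * u * ((p * s - r * q) * (p * r' - r * p'))
        + u * v * ((p * s - r * q) * (p * s' + q * r' - r * q' - s * p'))
        + v * v * ((p * s - r * q) * (q * s' - s * q'))" for u v
      by (simp add: algebra_simps)
    then have "(p * s - r * q) * ((u * p + v * q) * (u * r' + v * s') - (u * r + v * s) * (u * p' + v * q')) = 0"
      for u v
      by (simp only: k1 k2 k3 mult_zero_right add_0)
    then show ?thesis
      by (simp add: \<Delta>_def R_def Aw Cw defs)
  qed
  moreover have "line_poly \<Delta>"
    unfolding \<Delta>_def
    by (intro line_poly_diff line_poly_mult line_poly_upd[OF line_poly_upd[OF multiaffine_line_poly[OF A]]])
  moreover have "line_poly R"
    unfolding R_def using A C
    by (intro line_poly_diff line_poly_mult line_poly_upd multiaffine_line_poly)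
  moreover have "\<not> (\<forall>w. positive w \<longrightarrow> R w = 0)"
    using j by (auto simp: ratio_free_def R_def)
  ultimately have "\<Delta> w = 0"
    using line_poly_mult_eq_0[of \<Delta> R] w by blast
  then show ?thesis
    by (simp add: \<Delta>_def)
qed

definition mix :: "'v set \<Rightarrow> ('v \<Rightarrow> real) \<Rightarrow> ('v \<Rightarrow> real) \<Rightarrow> 'v \<Rightarrow> real" where
  "mix T u w = (\<lambda>i. if i \<in> T then u i else w i)"

lemma positive_mix: "positive u \<Longrightarrow> positive w \<Longrightarrow> positive (mix T u w)"
  by (auto simp: positive_def mix_def)

lemma mix_insert: "mix (insert i T) u w = (mix T u w)(i := u i)"
  by (auto simp: mix_def)

text \<open>
  Proportionality composes along a chain of weights as long as the intermediate value is nonzero.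
\<close>

lemma cross_mult_trans:
  fixes x p q r s v :: real
  assumes "x * p = v * q" "v * r = s * p" "v \<noteq> 0"
  shows "x * r = s * q"
proof -
  have "v * (x * r) = v * (s * q)"
    using assms(1,2) by algebra
  then show ?thesis
    using assms(3) by simp
qed

lemma ratio_free_mix:
  assumes F: "multiaffine F" and H: "multiaffine H"
    and pos: "\<And>w. positive w \<Longrightarrow> F w > 0"
    and "finite S" "\<And>i. i \<in> S \<Longrightarrow> ratio_free i F H" "positive u" "positive w"
  shows "F w * H (mix S u w) = F (mix S u w) * H w"
  using assms(4,5)
proof (induction S rule: finite_induct)
  case empty
  then show ?case by (simp add: mix_def)
next
  case (insert i S)
  define v where "v = mix S u w"
  have v: "positive v"
    using assms(6,7) by (simp add: v_def positive_mix)
  have e1: "F w * H v = F v * H w"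
    using insert unfolding v_def by blast
  have e2: "F v * H (v(i := u i)) = F (v(i := u i)) * H v"
    using ratio_free_upd[OF F H] insert.prems v by blast
  have "F w * H (v(i := u i)) = F (v(i := u i)) * H w"
    using cross_mult_trans[OF e1 e2] pos[OF v] by simp
  then show ?case
    unfolding mix_insert v_def[symmetric] .
qed

text \<open>
  In the two variables \<open>i\<close> and \<open>j\<close>, \<open>A\<close> is given by the \<open>2 \<times> 2\<close> matrix of its corner values, and any
  other choice of values changes the determinant of this matrix by a factor only.
\<close>

lemma separates_upd_upd:
  assumes A: "multiaffine A" and "i \<noteq> j"
    and eq: "A (w(i := 1, j := 1)) * A (w(i := 2, j := 2)) =
      A (w(i := 1, j := 2)) * A (w(i := 2, j := 1))"
  shows "A w * A (w(i := s, j := t)) = A (w(i := s)) * A (w(j := t))"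
proof -
  have tw: "w(j := t, i := u) = w(i := u, j := t)" for t u
    using \<open>i \<noteq> j\<close> by (rule fun_upd_twist[symmetric])
  have e: "A (w(i := x, j := y)) =
      (2 - y) * ((2 - x) * A (w(i := 1, j := 1)) + (x - 1) * A (w(i := 2, j := 1)))
      + (y - 1) * ((2 - x) * A (w(i := 1, j := 2)) + (x - 1) * A (w(i := 2, j := 2)))" for x y
    using multiaffine_upd[OF A, of "w(i := x)" j y] multiaffine_upd[OF A, of "w(j := 1)" i x]
      multiaffine_upd[OF A, of "w(j := 2)" i x] by (simp add: tw)
  have *: "A (w(i := x, j := y)) * A (w(i := s, j := t)) = A (w(i := s, j := y)) * A (w(i := x, j := t))" for x y
  proof -
    define P Q R S where "P = A (w(i := 1, j := 1))" and "Q = A (w(i := 2, j := 1))"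
      and "R = A (w(i := 1, j := 2))" and "S = A (w(i := 2, j := 2))"
    have "(y0 * (x0 * P + x1 * Q) + y1 * (x0 * R + x1 * S)) * (t0 * (s0 * P + s1 * Q) + t1 * (s0 * R + s1 * S))
        - (y0 * (s0 * P + s1 * Q) + y1 * (s0 * R + s1 * S)) * (t0 * (x0 * P + x1 * Q) + t1 * (x0 * R + x1 * S))
        = (x0 * s1 - x1 * s0) * (y0 * t1 - y1 * t0) * (P * S - R * Q)" for x0 x1 y0 y1 s0 s1 t0 t1
      by (simp add: algebra_simps)
    moreover have "P * S - R * Q = 0"
      using eq by (simp add: P_def Q_def R_def S_def)
    ultimately show ?thesis
      unfolding e[of x y] e[of s t] e[of s y] e[of x t] P_def[symmetric] Q_def[symmetric]
        R_def[symmetric] S_def[symmetric] by (metis eq_iff_diff_eq_0 mult_zero_right)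
  qed
  have "w(i := w i, j := w j) = w" "w(i := s, j := w j) = w(i := s)" "w(i := w i, j := t) = w(j := t)"
    using \<open>i \<noteq> j\<close> by auto
  then show ?thesis
    using *[of "w i" "w j"] by simp
qed

text \<open>
  Separation of single variables \<open>i \<in> T\<close>, \<open>j \<notin> T\<close> extends to sets of variables by changing one at a
  time; for \<open>S = T\<close> and \<open>S' = - T\<close> all variables change, which splits \<open>A\<close> completely.
\<close>

lemma separates_mix:
  fixes A :: "('v \<Rightarrow> real) \<Rightarrow> real"
  assumes pos: "\<And>w. positive w \<Longrightarrow> A w > 0" and u: "positive u" and "positive w"
    and sep: "\<And>i j w s t. i \<in> T \<Longrightarrow> j \<notin> T \<Longrightarrow> positive w \<Longrightarrow>
      A w * A (w(i := s, j := t)) = A (w(i := s)) * A (w(j := t))"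
    and "finite S" "S \<subseteq> T" "finite S'" "S' \<inter> T = {}"
  shows "A w * A (mix (S \<union> S') u w) = A (mix S u w) * A (mix S' u w)"
proof -
  have one: "A w * A ((mix S u w)(j := t)) = A (mix S u w) * A (w(j := t))"
    if "j \<notin> T" "positive w" for j t w
    using \<open>finite S\<close> \<open>S \<subseteq> T\<close>
  proof (induction S rule: finite_induct)
    case empty
    then show ?case by (simp add: mix_def)
  next
    case (insert i S)
    define v where "v = mix S u w"
    have v: "positive v"
      using u that by (simp add: v_def positive_mix)
    have e1: "A w * A (v(j := t)) = A v * A (w(j := t))"
      using insert unfolding v_def by blast
    have e2: "A v * A (v(i := u i, j := t)) = A (v(i := u i)) * A (v(j := t))"
      using sep insert.prems that(1) v by simp
    have "A w * A (v(i := u i, j := t)) = A (v(i := u i)) * A (w(j := t))"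
      using cross_mult_trans[OF e1 e2] pos[OF v] by simp
    then show ?case
      unfolding mix_insert v_def[symmetric] .
  qed
  show ?thesis
    using \<open>finite S'\<close> \<open>S' \<inter> T = {}\<close>
  proof (induction S' rule: finite_induct)
    case empty
    then show ?case by (simp add: mix_def)
  next
    case (insert j S')
    define v where "v = mix S' u w"
    have v: "positive v"
      using u assms(3) by (simp add: v_def positive_mix)
    have vS: "mix S u v = mix (S \<union> S') u w"
      by (auto simp: mix_def v_def)
    have e1: "A w * A (mix S u v) = A v * A (mix S u w)"
      using insert by (simp add: vS mult.commute) (simp add: v_def)
    have e2: "A v * A ((mix S u v)(j := u j)) = A (v(j := u j)) * A (mix S u v)"
      using one[of j v] insert.prems v by (simp add: mult.commute)
    have "A w * A ((mix S u v)(j := u j)) = A (mix S u w) * A (v(j := u j))"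
      using cross_mult_trans[OF e1 e2] pos[OF v] by (simp add: mult.commute)
    then show ?case
      unfolding vS Un_insert_right mix_insert v_def[symmetric] .
  qed
qed

text \<open>
  Here \<open>T\<close> is the set of variables on which \<open>A / C\<close> does not depend; off \<open>T\<close>, it is \<open>A / D\<close> that does
  not. With \<open>x\<close> and \<open>y\<close> the weights that agree with \<open>w\<close> on \<open>T\<close> and on \<open>- T\<close> respectively and with
  \<open>u\<close> elsewhere, \<open>A u * A w = A x * A y\<close>, while \<open>A / C\<close> is the same at \<open>w\<close> and \<open>y\<close>, and \<open>A / D\<close> the
  same at \<open>w\<close> and \<open>x\<close>. The formulas for \<open>C\<close> and \<open>D\<close> follow by division, and that for
  \<open>B = C * D / A\<close> from these.
\<close>

theorem multiaffine_cross_factor: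
  fixes A B C D :: "('v::finite \<Rightarrow> real) \<Rightarrow> real"
  assumes A: "multiaffine A" and B: "multiaffine B" and C: "multiaffine C" and D: "multiaffine D"
    and pos: "\<And>w. positive w \<Longrightarrow> A w > 0"
    and eq: "\<And>w. positive w \<Longrightarrow> A w * B w = C w * D w"
    and u: "positive u"
  obtains T where "\<And>w. positive w \<Longrightarrow>
    A u * A w = A (mix T w u) * A (mix (- T) w u) \<and>
    A u * B w = D (mix T w u) * C (mix (- T) w u) \<and>
    A u * C w = A (mix T w u) * C (mix (- T) w u) \<and>
    A u * D w = D (mix T w u) * A (mix (- T) w u)"
proof
  define T where "T = {i. ratio_free i A C}"
  fix w :: "'v \<Rightarrow> real" assume w: "positive w"
  have mix_Compl: "mix (- S) u w = mix S w u" for S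
    by (auto simp: mix_def)
  define x y where "x = mix T w u" and "y = mix (- T) w u"
  have xy: "positive x" "positive y"
    using u w by (simp_all add: x_def y_def positive_mix)
  have AC: "A w * C y = A y * C w"
    using ratio_free_mix[OF A C _ finite, of T u w] pos u w mix_Compl[of "- T"]
    by (auto simp: T_def y_def)
  have "ratio_free i A D" if "i \<in> - T" for i
    using ratio_free_dichotomy[OF A B C D eq, of i] that by (auto simp: T_def)
  then have AD: "A w * D x = A x * D w"
    using ratio_free_mix[OF A D _ finite, of "- T" u w] pos u w mix_Compl[of T]
    by (auto simp: x_def)
  have "A w * A (mix (- T \<union> T) u w) = A (mix (- T) u w) * A (mix T u w)"
  proof (rule separates_mix)
    fix i j v s t assume "i \<in> - T" "j \<notin> - T" "positive (v :: 'v \<Rightarrow> real)"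
    moreover from this have "i \<noteq> j"
      by auto
    ultimately show "A v * A (v(i := s, j := t)) = A (v(i := s)) * A (v(j := t))"
      using mixed_difference_vanishes[OF A C, of j i v] separates_upd_upd[OF A, of j i v t s]
        fun_upd_twist[of i j v]
      by (simp add: T_def mult.commute)
  qed (use pos u w in auto)
  moreover have "mix (- T \<union> T) u w = u"
    by (simp add: mix_def)
  ultimately have AA: "A u * A w = A x * A y"
    using mix_Compl[of T] mix_Compl[of "- T"] by (simp add: x_def y_def mult.commute)
  have nz: "A w \<noteq> 0" "A x \<noteq> 0" "A y \<noteq> 0"
    using pos w xy by (simp_all add: less_imp_neq[symmetric])
  have "(A u * C w) * A y = (A x * C y) * A y"
    using AA AC by algebra
  then have CC: "A u * C w = A x * C y"
    using nz by simp
  have "(A u * D w) * A x = (D x * A y) * A x"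
    using AA AD by algebra
  then have DD: "A u * D w = D x * A y"
    using nz by simp
  have "(A u * B w) * (A w * A y) = (A u * C w) * D w * A y"
    using eq[OF w] by (simp add: mult_ac)
  also have "\<dots> = C y * A y * (A x * D w)"
    by (simp add: CC mult_ac)
  also have "\<dots> = (D x * C y) * (A w * A y)"
    by (simp add: AD[symmetric] mult_ac)
  finally have "(A u * B w) * (A w * A y) = (D x * C y) * (A w * A y)" .
  then have "A u * B w = D x * C y"
    using nz by simp
  with AA CC DD show "A u * A w = A (mix T w u) * A (mix (- T) w u) \<and>
    A u * B w = D (mix T w u) * C (mix (- T) w u) \<and>
    A u * C w = A (mix T w u) * C (mix (- T) w u) \<and>
    A u * D w = D (mix T w u) * A (mix (- T) w u)"
    by (simp add: x_def y_def)
qed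

section \<open>Equality on a power set\<close>

text \<open>
  Two positive values of one weight determine the two parts of the polynomial that are constant and
  linear in it.
\<close>

lemma gen_eq_imp_coeff_eq:
  assumes "finite V" "\<And>w. positive w \<Longrightarrow> gen V a w = gen V b w" "X \<subseteq> V"
  shows "a X = b X"
  using assms
proof (induction V arbitrary: a b X rule: finite_induct)
  case empty
  from empty(1)[of "\<lambda>_. 1"] empty(2) show ?case
    by (simp add: gen_def positive_def)
next
  case (insert v V)
  have "gen V a w = gen V b w \<and> gen V (a \<circ> insert v) w = gen V (b \<circ> insert v) w"
    if "positive w" for w
    using insert.prems(1)[OF positive_upd, of w 1 v] insert.prems(1)[OF positive_upd, of w 2 v] that
    unfolding gen_insert[OF insert.hyps] gen_upd_outside[OF insert.hyps(2)] by simp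
  then have IH: "a Y = b Y" "(a \<circ> insert v) Y = (b \<circ> insert v) Y" if "Y \<subseteq> V" for Y
    using insert.IH that by blast+
  show ?case
  proof (cases "v \<in> X")
    case True
    then show ?thesis
      using IH(2)[of "X - {v}"] insert.prems(2) by (auto simp: insert_absorb)
  next
    case False
    then show ?thesis
      using IH(1)[of X] insert.prems(2) by auto
  qed
qed

lemma sum_subsets_split:
  fixes F :: "'v::finite set \<Rightarrow> real"
  shows "sum F UNIV = (\<Sum>X\<in>Pow T. \<Sum>Y\<in>Pow (- T). F (X \<union> Y))"
proof -
  have "sum F UNIV = (\<Sum>p\<in>Pow T \<times> Pow (- T). F (fst p \<union> snd p))"
    by (rule sum.reindex_bij_witness[where i = "\<lambda>p. fst p \<union> snd p" and j = "\<lambda>Z. (Z \<inter> T, Z \<inter> - T)"])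
      (auto intro: arg_cong[where f = F])
  then show ?thesis
    by (simp add: sum.cartesian_product case_prod_beta)
qed

lemma gen_split:
  fixes a :: "'v::finite set \<Rightarrow> real"
  shows "gen UNIV a w = (\<Sum>X\<in>Pow T. \<Sum>Y\<in>Pow (- T). a (X \<union> Y) * (prod w X * prod w Y))"
proof -
  have "prod w (X \<union> Y) = prod w X * prod w Y" if "X \<subseteq> T" "Y \<subseteq> - T" for X Y
    using that by (intro prod.union_disjoint) auto
  then show ?thesis
    by (simp add: gen_def sum_subsets_split[of _ T])
qed

text \<open>
  Its generating polynomial arises from that of \<open>a\<close> by putting all weights outside \<open>T\<close> equal to \<open>1\<close>
  (\<open>gen_mix_one\<close>).
\<close>

definition marginal :: "'v set \<Rightarrow> ('v set \<Rightarrow> real) \<Rightarrow> 'v set \<Rightarrow> real" where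
  "marginal T a X = (\<Sum>Y\<in>Pow (- T). a (X \<union> Y))"

lemma gen_mix_one:
  fixes a :: "'v::finite set \<Rightarrow> real"
  shows "gen UNIV a (mix T w (\<lambda>_. 1)) = gen T (marginal T a) w"
proof -
  have "prod (mix T w (\<lambda>_. 1)) X = prod w X" if "X \<subseteq> T" for X
    using that by (intro prod.cong) (auto simp: mix_def)
  moreover have "prod (mix T w (\<lambda>_. 1)) Y = 1" if "Y \<subseteq> - T" for Y
    using that by (intro prod.neutral) (auto simp: mix_def)
  ultimately show ?thesis
    unfolding gen_split[of _ _ T] by (simp add: gen_def marginal_def sum_distrib_right)
qed

lemma gen_mult_Compl:
  fixes f g :: "'v::finite set \<Rightarrow> real"
  shows "gen T f w * gen (- T) g w = gen UNIV (\<lambda>Z. f (Z \<inter> T) * g (Z \<inter> - T)) w"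
proof -
  have "(X \<union> Y) \<inter> T = X" "(X \<union> Y) \<inter> - T = Y" if "X \<subseteq> T" "Y \<subseteq> - T" for X Y
    using that by auto
  then show ?thesis
    unfolding gen_split[of _ _ T] by (simp add: gen_def sum_product mult_ac)
qed

lemma gen_product_coeff:
  fixes a f g :: "'v::finite set \<Rightarrow> real"
  assumes "\<And>w. positive w \<Longrightarrow> k * gen UNIV a w =
      gen UNIV f (mix T w (\<lambda>_. 1)) * gen UNIV g (mix (- T) w (\<lambda>_. 1))"
  shows "k * a Z = marginal T f (Z \<inter> T) * marginal (- T) g (Z \<inter> - T)"
proof -
  have "gen UNIV (\<lambda>Z. k * a Z) w =
      gen UNIV (\<lambda>Z. marginal T f (Z \<inter> T) * marginal (- T) g (Z \<inter> - T)) w" if "positive w" for w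
  proof -
    have "gen UNIV (\<lambda>Z. k * a Z) w = k * gen UNIV a w"
      by (simp add: gen_def sum_distrib_left mult.assoc)
    then show ?thesis
      using assms[OF that] by (simp add: gen_mix_one gen_mult_Compl)
  qed
  then show ?thesis
    by (rule gen_eq_imp_coeff_eq[OF finite]) auto
qed

text \<open>
  The four constants of a cross-factorization can be taken to be \<open>1\<close> here, as the common constant
  \<open>1 / k\<close> is absorbed by \<open>f1\<close> and \<open>g1\<close>. Without the assumption on the products of the sums the generating
  polynomials may vanish, and there is nothing to divide by.
\<close>

theorem four_fun_equality_Pow:
  fixes a b c d :: "'v::finite set \<Rightarrow> real"
  assumes ff: "four_fun UNIV a b c d"
    and eq: "sum a UNIV * sum b UNIV = sum c UNIV * sum d UNIV"
    and nz: "sum a UNIV * sum b UNIV \<noteq> 0"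
  obtains T f1 f2 g1 g2 where
    "\<And>X. f1 X \<ge> 0 \<and> f2 X \<ge> 0 \<and> g1 X \<ge> 0 \<and> g2 X \<ge> (0::real)"
    "\<And>Z. a Z = f1 (Z \<inter> T) * f2 (Z \<inter> - T)" "\<And>Z. b Z = g1 (Z \<inter> T) * g2 (Z \<inter> - T)"
    "\<And>Z. c Z = f1 (Z \<inter> T) * g2 (Z \<inter> - T)" "\<And>Z. d Z = g1 (Z \<inter> T) * f2 (Z \<inter> - T)"
proof -
  have nn: "a X \<ge> 0" "b X \<ge> 0" "c X \<ge> 0" "d X \<ge> 0" for X
    using ff by (simp_all add: four_fun_def)
  have gen_pos: "gen UNIV e w > 0"
    if "\<And>X. e X \<ge> 0" "sum e UNIV \<noteq> 0" "positive w" for e :: "'v set \<Rightarrow> real" and w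
  proof -
    obtain X where "e X > 0"
      using \<open>sum e UNIV \<noteq> 0\<close> \<open>\<And>X. e X \<ge> 0\<close> by (metis less_eq_real_def sum.neutral)
    moreover have "prod w Y > 0" for Y
      using \<open>positive w\<close> by (simp add: positive_def prod_pos)
    ultimately show ?thesis
      unfolding gen_def using \<open>\<And>X. e X \<ge> 0\<close>
      by (intro sum_pos2[of _ X]) (auto simp: less_imp_le)
  qed
  have nz': "sum a UNIV \<noteq> 0" "sum b UNIV \<noteq> 0" "sum c UNIV \<noteq> 0" "sum d UNIV \<noteq> 0"
    using nz eq by auto
  have one: "positive (\<lambda>_::'v. 1)"
    by (simp add: positive_def)
  define k where "k = gen UNIV a (\<lambda>_. 1)"
  have k: "k > 0"
    unfolding k_def using gen_pos nn nz' one by blast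
  obtain T where T: "\<And>w. positive w \<Longrightarrow>
    k * gen UNIV a w = gen UNIV a (mix T w (\<lambda>_. 1)) * gen UNIV a (mix (- T) w (\<lambda>_. 1)) \<and>
    k * gen UNIV b w = gen UNIV d (mix T w (\<lambda>_. 1)) * gen UNIV c (mix (- T) w (\<lambda>_. 1)) \<and>
    k * gen UNIV c w = gen UNIV a (mix T w (\<lambda>_. 1)) * gen UNIV c (mix (- T) w (\<lambda>_. 1)) \<and>
    k * gen UNIV d w = gen UNIV d (mix T w (\<lambda>_. 1)) * gen UNIV a (mix (- T) w (\<lambda>_. 1))"
    unfolding k_def
    by (rule multiaffine_cross_factor[OF multiaffine_gen multiaffine_gen multiaffine_gen multiaffine_gen
          _ gen_equality_all_weights[OF ff eq] one])
      (use gen_pos nn nz' in auto)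
  have coeff: "k * a Z = marginal T a (Z \<inter> T) * marginal (- T) a (Z \<inter> - T)"
    "k * b Z = marginal T d (Z \<inter> T) * marginal (- T) c (Z \<inter> - T)"
    "k * c Z = marginal T a (Z \<inter> T) * marginal (- T) c (Z \<inter> - T)"
    "k * d Z = marginal T d (Z \<inter> T) * marginal (- T) a (Z \<inter> - T)" for Z
    using T by (blast intro!: gen_product_coeff)+
  have mnn: "marginal S e X \<ge> 0" if "\<And>X. e X \<ge> 0" for S X and e :: "'v set \<Rightarrow> real"
    unfolding marginal_def using that by (intro sum_nonneg)
  show ?thesis
  proof
    show "marginal T a X / k \<ge> 0 \<and> marginal (- T) a X \<ge> 0 \<and> marginal T d X / k \<ge> 0
        \<and> marginal (- T) c X \<ge> 0" for X
      using mnn nn k by simp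
    show "a Z = marginal T a (Z \<inter> T) / k * marginal (- T) a (Z \<inter> - T)"
      "b Z = marginal T d (Z \<inter> T) / k * marginal (- T) c (Z \<inter> - T)"
      "c Z = marginal T a (Z \<inter> T) / k * marginal (- T) c (Z \<inter> - T)"
      "d Z = marginal T d (Z \<inter> T) / k * marginal (- T) a (Z \<inter> - T)" for Z
      using coeff[of Z] k by (simp_all add: field_simps)
  qed
qed

section \<open>From sets to lattices\<close>

text \<open>
  Birkhoff's representation by join-prime elements. A bottom element, which is join-prime by this
  definition, only adds a coordinate shared by all sets.
\<close>

definition primes_below :: "'a::distrib_lattice \<Rightarrow> 'a set" where
  "primes_below x = {p. (\<forall>u v. p \<le> sup u v \<longrightarrow> p \<le> u \<or> p \<le> v) \<and> p \<le> x}"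

lemma primes_below_sup: "primes_below (sup x y) = primes_below x \<union> primes_below y"
  unfolding primes_below_def by (auto intro: le_supI1 le_supI2)

lemma primes_below_inf: "primes_below (inf x y) = primes_below x \<inter> primes_below y"
  unfolding primes_below_def by auto

text \<open>
  If \<open>x \<le> y\<close> fails, a minimal element \<open>p\<close> among those below \<open>x\<close> but not below \<open>y\<close> is join-prime: otherwise,
  by distributivity, \<open>p\<close> is the join of two smaller elements, both below \<open>y\<close>.
\<close>

lemma inj_primes_below: "inj (primes_below :: 'a::{finite, distrib_lattice} \<Rightarrow> _)"
proof -
  have le: "x \<le> y" if sub: "primes_below x \<subseteq> primes_below y" for x y :: 'a
  proof (rule ccontr)
    assume "\<not> x \<le> y"
    then have "{z. z \<le> x \<and> \<not> z \<le> y} \<noteq> {}"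
      by auto
    then obtain p where p: "p \<le> x" "\<not> p \<le> y" and min: "\<And>z. z \<le> x \<Longrightarrow> \<not> z \<le> y \<Longrightarrow> z \<le> p \<Longrightarrow> z = p"
      using finite_has_minimal[of "{z. z \<le> x \<and> \<not> z \<le> y}"] by (auto simp: eq_commute)
    have "p \<le> u \<or> p \<le> v" if "p \<le> sup u v" for u v
    proof (rule ccontr)
      assume no: "\<not> (p \<le> u \<or> p \<le> v)"
      have "inf p u \<le> y" "inf p v \<le> y"
        using min[of "inf p u"] min[of "inf p v"] p(1) no
        by (metis inf.cobounded1 inf.cobounded2 order_trans)+
      moreover have "p = sup (inf p u) (inf p v)"
        using that by (simp add: inf_sup_distrib1[symmetric] inf_absorb1)
      ultimately show False
        using p(2) by (metis sup.boundedI)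
    qed
    then have "p \<in> primes_below x"
      using p(1) by (simp add: primes_below_def)
    then show False
      using sub p(2) by (auto simp: primes_below_def)
  qed
  show ?thesis
    by (intro injI order_antisym le) auto
qed

lemma distrib_lattice_on_sets:
  assumes "\<And>X Y. X \<in> L \<Longrightarrow> Y \<in> L \<Longrightarrow> X \<union> Y \<in> L \<and> X \<inter> Y \<in> L"
  shows "distrib_lattice_on L (\<union>) (\<inter>)"
  unfolding distrib_lattice_on_def using assms by auto

text \<open>
  The factors are the traces of the image of \<open>\<phi>\<close> on \<open>T\<close> and on \<open>- T\<close>, and the isomorphism takes the union
  of two traces; \<open>split\<close> says that every such union is again in the image.
\<close>

lemma cross_factorI_split:
  fixes \<phi> :: "'a::distrib_lattice \<Rightarrow> 'v set" and a b c d :: "'a \<Rightarrow> real"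
  assumes inj: "inj \<phi>" and sup: "\<And>x y. \<phi> (sup x y) = \<phi> x \<union> \<phi> y"
    and inf: "\<And>x y. \<phi> (inf x y) = \<phi> x \<inter> \<phi> y"
    and split: "\<And>x y. \<exists>z. \<phi> z = (\<phi> x \<inter> T) \<union> (\<phi> y \<inter> - T)"
    and nonneg: "\<And>X. f1 X \<ge> 0 \<and> f2 X \<ge> 0 \<and> g1 X \<ge> 0 \<and> g2 X \<ge> (0::real)"
    and a: "\<And>x. a x = f1 (\<phi> x \<inter> T) * f2 (\<phi> x \<inter> - T)"
    and b: "\<And>x. b x = g1 (\<phi> x \<inter> T) * g2 (\<phi> x \<inter> - T)"
    and c: "\<And>x. c x = f1 (\<phi> x \<inter> T) * g2 (\<phi> x \<inter> - T)"
    and d: "\<And>x. d x = g1 (\<phi> x \<inter> T) * f2 (\<phi> x \<inter> - T)"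
  shows "cross_factor a b c d"
proof -
  define L1 where "L1 = range (\<lambda>x. \<phi> x \<inter> T)"
  define L2 where "L2 = range (\<lambda>x. \<phi> x \<inter> - T)"
  define h where "h = (\<lambda>(X, Y). inv \<phi> (X \<union> Y))"
  have cl1: "X \<union> Y \<in> L1 \<and> X \<inter> Y \<in> L1" if XY: "X \<in> L1" "Y \<in> L1" for X Y
  proof -
    obtain x y where "X = \<phi> x \<inter> T" "Y = \<phi> y \<inter> T"
      using XY by (auto simp: L1_def)
    then have "X \<union> Y = \<phi> (Lattices.sup x y) \<inter> T" "X \<inter> Y = \<phi> (Lattices.inf x y) \<inter> T"
      by (auto simp: sup inf)
    then show ?thesis
      by (simp add: L1_def)
  qed
  have cl2: "X \<union> Y \<in> L2 \<and> X \<inter> Y \<in> L2" if XY: "X \<in> L2" "Y \<in> L2" for X Y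
  proof -
    obtain x y where "X = \<phi> x \<inter> - T" "Y = \<phi> y \<inter> - T"
      using XY by (auto simp: L2_def)
    then have "X \<union> Y = \<phi> (Lattices.sup x y) \<inter> - T" "X \<inter> Y = \<phi> (Lattices.inf x y) \<inter> - T"
      by (auto simp: sup inf)
    then show ?thesis
      by (simp add: L2_def)
  qed
  have h: "\<phi> (h (X, Y)) = X \<union> Y" if XY: "X \<in> L1" "Y \<in> L2" for X Y
  proof -
    have "X \<union> Y \<in> range \<phi>"
      using split XY by (auto simp: L1_def L2_def) (metis rangeI)
    then show ?thesis
      by (simp add: h_def f_inv_into_f)
  qed
  have sub: "X \<subseteq> T" "Y \<subseteq> - T" if "X \<in> L1" "Y \<in> L2" for X Y
    using that by (auto simp: L1_def L2_def)
  have parts: "\<phi> (h (X, Y)) \<inter> T = X" "\<phi> (h (X, Y)) \<inter> - T = Y" if "X \<in> L1" "Y \<in> L2" for X Y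
    using h[OF that] sub[OF that] by auto
  have "bij_betw h (L1 \<times> L2) UNIV"
    unfolding bij_betw_def
  proof
    have "(\<lambda>z. (\<phi> z \<inter> T, \<phi> z \<inter> - T)) (h p) = p" if "p \<in> L1 \<times> L2" for p
      using parts that by (cases p) simp
    then show "inj_on h (L1 \<times> L2)"
      by (rule inj_on_inverseI)
    have "h (\<phi> x \<inter> T, \<phi> x \<inter> - T) = x" for x
    proof -
      have "\<phi> x \<inter> T \<union> \<phi> x \<inter> - T = \<phi> x"
        by auto
      then show ?thesis
        using inj by (simp add: h_def)
    qed
    then show "h ` (L1 \<times> L2) = UNIV"
      by (auto simp: L1_def L2_def image_iff) metis
  qed
  moreover have "h (prod_op (\<union>) (\<union>) p q) = Lattices.sup (h p) (h q) \<and>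
      h (prod_op (\<inter>) (\<inter>) p q) = Lattices.inf (h p) (h q)"
    if pq_in: "p \<in> L1 \<times> L2" "q \<in> L1 \<times> L2" for p q
  proof -
    obtain X Y X' Y' where pq: "p = (X, Y)" "q = (X', Y')"
      and X: "X \<in> L1" "X' \<in> L1" and Y: "Y \<in> L2" "Y' \<in> L2"
      using pq_in by (cases p, cases q) auto
    have "\<phi> (h (X \<union> X', Y \<union> Y')) = \<phi> (Lattices.sup (h p) (h q))"
      "\<phi> (h (X \<inter> X', Y \<inter> Y')) = \<phi> (Lattices.inf (h p) (h q))"
      using X Y cl1[OF X] cl2[OF Y] sub[OF X(1) Y(1)] sub[OF X(2) Y(2)]
      by (auto simp: pq sup inf h)
    then show ?thesis
      using inj by (auto simp: prod_op_def pq dest: injD)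
  qed
  ultimately have iso: "lattice_iso h (L1 \<times> L2) (prod_op (\<union>) (\<union>)) (prod_op (\<inter>) (\<inter>))
      UNIV Lattices.sup Lattices.inf"
    by (simp add: lattice_iso_def)
  have "cross_factor_via L1 (\<union>) (\<inter>) L2 (\<union>) (\<inter>) a b c d"
    unfolding cross_factor_via_def
    using cl1 cl2 iso nonneg parts
    by (intro conjI distrib_lattice_on_sets exI[of _ h] exI[of _ f1] exI[of _ g1] exI[of _ f2]
        exI[of _ g2] exI[of _ "1::real"]) (auto simp: a b c d)
  then show ?thesis
    by (rule cross_factorI)
qed

lemma lattice_closure_induct [consumes 1, case_names base sup_inf]:
  assumes "x \<in> lattice_closure S" "\<And>s. s \<in> S \<Longrightarrow> P s"
    and "\<And>u v. P u \<Longrightarrow> P v \<Longrightarrow> P (sup u v) \<and> P (inf u v)"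
  shows "P x"
proof -
  have "sublattice {x. P x}"
    using assms(3) by (simp add: sublattice_def)
  then have "lattice_closure S \<subseteq> {x. P x}"
    unfolding lattice_closure_def using assms(2) by (intro hull_minimal) auto
  then show ?thesis
    using assms(1) by auto
qed

text \<open>
  For a fixed second argument, recombination with respect to \<open>T\<close> commutes with union and intersection
  in the first, and vice versa. So it suffices to recombine generators, extending first one argument
  and then the other to the closure.
\<close>

lemma split_closed:
  fixes \<phi> :: "'a::distrib_lattice \<Rightarrow> 'v set"
  assumes sup: "\<And>x y. \<phi> (sup x y) = \<phi> x \<union> \<phi> y"
    and inf: "\<And>x y. \<phi> (inf x y) = \<phi> x \<inter> \<phi> y"
    and S: "\<And>x y. x \<in> S \<Longrightarrow> y \<in> S \<Longrightarrow> \<exists>z. \<phi> z = (\<phi> x \<inter> T) \<union> (\<phi> y \<inter> - T)"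
    and xy: "x \<in> lattice_closure S" "y \<in> lattice_closure S"
  shows "\<exists>z. \<phi> z = (\<phi> x \<inter> T) \<union> (\<phi> y \<inter> - T)"
proof -
  have base: "\<exists>z. \<phi> z = (\<phi> x \<inter> T) \<union> (\<phi> s \<inter> - T)" if "s \<in> S" for s
    using xy(1)
  proof (induction rule: lattice_closure_induct)
    case (sup_inf u v)
    then obtain z z' where "\<phi> z = (\<phi> u \<inter> T) \<union> (\<phi> s \<inter> - T)" "\<phi> z' = (\<phi> v \<inter> T) \<union> (\<phi> s \<inter> - T)"
      by auto
    then have "\<phi> (Lattices.sup z z') = (\<phi> (Lattices.sup u v) \<inter> T) \<union> (\<phi> s \<inter> - T)" "\<phi> (Lattices.inf z z') = (\<phi> (Lattices.inf u v) \<inter> T) \<union> (\<phi> s \<inter> - T)"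
      unfolding sup inf by blast+
    then show ?case
      by blast
  next
    case (base r)
    then show ?case
      using S that by blast
  qed
  show ?thesis
    using xy(2)
  proof (induction rule: lattice_closure_induct)
    case (sup_inf u v)
    then obtain z z' where "\<phi> z = (\<phi> x \<inter> T) \<union> (\<phi> u \<inter> - T)" "\<phi> z' = (\<phi> x \<inter> T) \<union> (\<phi> v \<inter> - T)"
      by auto
    then have "\<phi> (Lattices.sup z z') = (\<phi> x \<inter> T) \<union> (\<phi> (Lattices.sup u v) \<inter> - T)" "\<phi> (Lattices.inf z z') = (\<phi> x \<inter> T) \<union> (\<phi> (Lattices.inf u v) \<inter> - T)"
      unfolding sup inf by blast+
    then show ?case
      by blast
  qed (rule base)
qed

lemma cross_factor_imp_equality:
  fixes a b c d :: "'a::{finite, distrib_lattice} \<Rightarrow> real"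
  assumes "cross_factor a b c d"
  shows "sum a UNIV * sum b UNIV = sum c UNIV * sum d UNIV"
proof -
  obtain L1 L2 :: "'a set" and j1 m1 j2 m2 where "cross_factor_via L1 j1 m1 L2 j2 m2 a b c d"
    using assms by (auto simp: cross_factor_def)
  then obtain h f1 g1 f2 g2 and \<alpha> \<beta> \<gamma> \<delta> :: real where
    "lattice_iso h (L1 \<times> L2) (prod_op j1 j2) (prod_op m1 m2) UNIV sup inf" and
    const: "\<alpha> * \<beta> = \<gamma> * \<delta>" and
    eqs: "\<forall>x1\<in>L1. \<forall>x2\<in>L2.
           a (h (x1, x2)) = \<alpha> * f1 x1 * f2 x2 \<and> b (h (x1, x2)) = \<beta> * g1 x1 * g2 x2 \<and>
           c (h (x1, x2)) = \<gamma> * f1 x1 * g2 x2 \<and> d (h (x1, x2)) = \<delta> * g1 x1 * f2 x2"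
    unfolding cross_factor_via_def by metis
  then have bij: "bij_betw h (L1 \<times> L2) UNIV"
    by (simp add: lattice_iso_def)
  have sum: "sum e UNIV = \<kappa> * sum f L1 * sum g L2"
    if "\<And>x y. x \<in> L1 \<Longrightarrow> y \<in> L2 \<Longrightarrow> e (h (x, y)) = \<kappa> * f x * g y" for e f g and \<kappa> :: real
  proof -
    have "sum e UNIV = (\<Sum>p\<in>L1 \<times> L2. e (h p))"
      by (rule sum.reindex_bij_betw[OF bij, symmetric])
    also have "\<dots> = (\<Sum>(x, y)\<in>L1 \<times> L2. \<kappa> * f x * g y)"
      using that by (intro sum.cong) auto
    also have "\<dots> = (\<Sum>x\<in>L1. \<Sum>y\<in>L2. \<kappa> * f x * g y)"
      by (rule sum.cartesian_product[symmetric])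
    finally show ?thesis
      by (simp only: sum_distrib_left[symmetric] sum_distrib_right[symmetric])
  qed
  have "sum a UNIV = \<alpha> * sum f1 L1 * sum f2 L2" "sum b UNIV = \<beta> * sum g1 L1 * sum g2 L2"
    "sum c UNIV = \<gamma> * sum f1 L1 * sum g2 L2" "sum d UNIV = \<delta> * sum g1 L1 * sum f2 L2"
    using eqs by (intro sum; blast)+
  then show ?thesis
    using const by algebra
qed

text \<open>
  One of \<open>a\<close>, \<open>b\<close> and one of \<open>c\<close>, \<open>d\<close> vanishes, and these two have a factor in common. If it is \<open>f1\<close>,
  say, let the first lattice be trivial with \<open>f1 = 0\<close> and \<open>g1 = 1\<close>; the second one is the whole
  lattice, with the two remaining functions as \<open>f2\<close> and \<open>g2\<close>.
\<close>

lemma equality_imp_cross_factor_zero: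
  fixes a b c d :: "'a::{finite, distrib_lattice} \<Rightarrow> real"
  assumes nonneg: "\<And>x. a x \<ge> 0 \<and> b x \<ge> 0 \<and> c x \<ge> 0 \<and> d x \<ge> 0"
    and "sum a UNIV * sum b UNIV = 0" "sum c UNIV * sum d UNIV = 0"
  shows "cross_factor a b c d"
proof -
  note I = cross_factorI_split[OF inj_primes_below primes_below_sup primes_below_inf]
  have inv: "inv primes_below (primes_below x) = x" for x :: 'a
    using inj_primes_below by (rule inv_f_f)
  have "(\<forall>x. a x = 0) \<or> (\<forall>x. b x = 0)" "(\<forall>x. c x = 0) \<or> (\<forall>x. d x = 0)"
    using assms(2,3) nonneg by (auto simp: sum_nonneg_eq_0_iff)
  then consider "\<And>x. a x = 0 \<and> c x = 0" | "\<And>x. b x = 0 \<and> d x = 0"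
    | "\<And>x. a x = 0 \<and> d x = 0" | "\<And>x. b x = 0 \<and> c x = 0"
    by metis
  then show ?thesis
  proof cases
    case 1
    show ?thesis
      by (rule I[of "{}" "\<lambda>_. 0" "d \<circ> inv primes_below" "\<lambda>_. 1" "b \<circ> inv primes_below"])
        (use 1 nonneg in \<open>auto simp: inv\<close>)
  next
    case 2
    show ?thesis
      by (rule I[of "{}" "\<lambda>_. 1" "a \<circ> inv primes_below" "\<lambda>_. 0" "c \<circ> inv primes_below"])
        (use 2 nonneg in \<open>auto simp: inv\<close>)
  next
    case 3
    show ?thesis
      by (rule I[of UNIV "c \<circ> inv primes_below" "\<lambda>_. 0" "b \<circ> inv primes_below" "\<lambda>_. 1"])
        (use 3 nonneg in \<open>auto simp: inv\<close>)
  next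
    case 4
    show ?thesis
      by (rule I[of UNIV "a \<circ> inv primes_below" "\<lambda>_. 1" "d \<circ> inv primes_below" "\<lambda>_. 0"])
        (use 4 nonneg in \<open>auto simp: inv\<close>)
  qed
qed

text \<open>
  The functions are extended by zero to all sets of coordinates. By the factorization, the sum of the
  four extensions is \<open>(f1 + g1) * (f2 + g2)\<close>, so its support is closed under recombination with
  respect to \<open>T\<close>; being zero off the image of \<open>\<phi>\<close>, it has its support there.
\<close>

lemma equality_imp_cross_factor_pos:
  fixes a b c d :: "'a::{finite, distrib_lattice} \<Rightarrow> real"
  assumes nonneg: "\<And>x. a x \<ge> 0 \<and> b x \<ge> 0 \<and> c x \<ge> 0 \<and> d x \<ge> 0"
    and le: "\<And>x y. a x * b y \<le> c (sup x y) * d (inf x y)"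
    and closure: "lattice_closure (supp (\<lambda>x. a x + b x + c x + d x)) = UNIV"
    and eq: "sum a UNIV * sum b UNIV = sum c UNIV * sum d UNIV"
    and nz: "sum a UNIV * sum b UNIV \<noteq> 0"
  shows "cross_factor a b c d"
proof -
  define \<phi> where "\<phi> = (primes_below :: 'a \<Rightarrow> 'a set)"
  have inj: "inj \<phi>" and sup: "\<phi> (Lattices.sup x y) = \<phi> x \<union> \<phi> y"
    and inf: "\<phi> (Lattices.inf x y) = \<phi> x \<inter> \<phi> y" for x y
    by (simp_all add: \<phi>_def inj_primes_below primes_below_sup primes_below_inf)
  have inv: "inv \<phi> (\<phi> x) = x" for x
    using inj by simp
  define ext where "ext = (\<lambda>e Z. if Z \<in> range \<phi> then e (inv \<phi> Z) else (0::real))"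
  have ext: "ext e (\<phi> x) = e x" for e x
    by (simp add: ext_def inv)
  have sum_ext: "sum (ext e) UNIV = sum e UNIV" for e
  proof -
    have "sum (ext e) UNIV = sum (ext e) (range \<phi>)"
      by (rule sum.mono_neutral_right) (auto simp: ext_def)
    then show ?thesis
      by (simp add: sum.reindex[OF inj] ext)
  qed
  have ext_nonneg: "ext e X \<ge> 0" if "\<And>x. e x \<ge> 0" for e X
    using that by (simp add: ext_def)
  have ff: "four_fun UNIV (ext a) (ext b) (ext c) (ext d)"
    unfolding four_fun_def
  proof (intro conjI allI impI)
    fix X Y
    show "ext a X * ext b Y \<le> ext c (X \<union> Y) * ext d (X \<inter> Y)"
    proof (cases "X \<in> range \<phi> \<and> Y \<in> range \<phi>")
      case True
      then obtain x y where "X = \<phi> x" "Y = \<phi> y"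
        by auto
      then show ?thesis
        using le[of x y] by (simp add: ext sup[symmetric] inf[symmetric])
    next
      case False
      then have "ext a X * ext b Y = 0"
        by (auto simp: ext_def)
      moreover have "ext c (X \<union> Y) \<ge> 0" "ext d (X \<inter> Y) \<ge> 0"
        using ext_nonneg nonneg by blast+
      ultimately show ?thesis
        by (metis mult_nonneg_nonneg)
    qed
  qed (use ext_nonneg nonneg in auto)
  obtain T f1 f2 g1 g2 where
    fg: "\<And>X. f1 X \<ge> 0 \<and> f2 X \<ge> 0 \<and> g1 X \<ge> 0 \<and> g2 X \<ge> (0::real)" and
    abcd: "\<And>Z. ext a Z = f1 (Z \<inter> T) * f2 (Z \<inter> - T)" "\<And>Z. ext b Z = g1 (Z \<inter> T) * g2 (Z \<inter> - T)"
    "\<And>Z. ext c Z = f1 (Z \<inter> T) * g2 (Z \<inter> - T)" "\<And>Z. ext d Z = g1 (Z \<inter> T) * f2 (Z \<inter> - T)"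
    using four_fun_equality_Pow[OF ff] eq nz unfolding sum_ext by metis
  define S where "S = supp (\<lambda>x. a x + b x + c x + d x)"
  have total: "ext a Z + ext b Z + ext c Z + ext d Z =
      (f1 (Z \<inter> T) + g1 (Z \<inter> T)) * (f2 (Z \<inter> - T) + g2 (Z \<inter> - T))" for Z
    unfolding abcd by (simp add: algebra_simps)
  have S: "\<exists>z. \<phi> z = (\<phi> x \<inter> T) \<union> (\<phi> y \<inter> - T)" if "x \<in> S" "y \<in> S" for x y
  proof -
    let ?Z = "(\<phi> x \<inter> T) \<union> (\<phi> y \<inter> - T)"
    have "(f1 (\<phi> x \<inter> T) + g1 (\<phi> x \<inter> T)) * (f2 (\<phi> x \<inter> - T) + g2 (\<phi> x \<inter> - T)) > 0"
      "(f1 (\<phi> y \<inter> T) + g1 (\<phi> y \<inter> T)) * (f2 (\<phi> y \<inter> - T) + g2 (\<phi> y \<inter> - T)) > 0"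
      using that total[of "\<phi> x"] total[of "\<phi> y"] by (simp_all add: S_def supp_def ext)
    moreover have "?Z \<inter> T = \<phi> x \<inter> T" "?Z \<inter> - T = \<phi> y \<inter> - T"
      by auto
    ultimately have "ext a ?Z + ext b ?Z + ext c ?Z + ext d ?Z \<noteq> 0"
      unfolding total by (metis less_irrefl mult_eq_0_iff)
    then have "?Z \<in> range \<phi>"
      by (auto simp: ext_def split: if_splits)
    then show ?thesis
      by (metis rangeE)
  qed
  have cl: "lattice_closure S = UNIV"
    unfolding S_def by (rule closure)
  have split: "\<exists>z. \<phi> z = (\<phi> x \<inter> T) \<union> (\<phi> y \<inter> - T)" for x y
    by (rule split_closed[where S = S, OF sup inf S]) (simp_all only: cl UNIV_I)
  show ?thesis
    by (rule cross_factorI_split[where ?f1.0 = f1 and ?f2.0 = f2 and ?g1.0 = g1 and ?g2.0 = g2,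
          OF inj sup inf split fg]) (simp_all only: abcd[symmetric] ext)
qed

theorem theorem1p3:
  fixes a b c d :: "'a::{finite, distrib_lattice} \<Rightarrow> real"
  assumes "\<And>x. a x \<ge> 0" and "\<And>x. b x \<ge> 0" and "\<And>x. c x \<ge> 0" and "\<And>x. d x \<ge> 0"
    and "\<And>x y. a x * b y \<le> c (sup x y) * d (inf x y)"
    and "lattice_closure (supp (\<lambda>x. a x + b x + c x + d x)) = UNIV"
  shows "(\<Sum>x\<in>UNIV. a x) * (\<Sum>x\<in>UNIV. b x) = (\<Sum>x\<in>UNIV. c x) * (\<Sum>x\<in>UNIV. d x)
    \<longleftrightarrow> cross_factor a b c d"
proof
  assume eq: "(\<Sum>x\<in>UNIV. a x) * (\<Sum>x\<in>UNIV. b x) = (\<Sum>x\<in>UNIV. c x) * (\<Sum>x\<in>UNIV. d x)"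
  show "cross_factor a b c d"
  proof (cases "sum a UNIV * sum b UNIV = 0")
    case True
    then show ?thesis
      using eq assms(1-4) by (intro equality_imp_cross_factor_zero) auto
  next
    case False
    then show ?thesis
      using eq assms by (intro equality_imp_cross_factor_pos) auto
  qed
qed (rule cross_factor_imp_equality)

end
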